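(* Let $v_1\ge v_2>2$ with $v_2/2\notin\mathbb{Z}$, and let $m=\lfloor v_2/2\rfloor$. A strategy profile $(X,Y)$ is a Nash equilibrium of the discrete all-pay auction with valuations $v_1,v_2$ if and only if the following holds: (i) If $\lfloor v_1/2\rfloor=\lfloor v_2/2\rfloor$: $X=\lambda U_{\mathrm{O}}^m+(1-\lambda)U_{\mathrm{E}}^m$ and $Y=\kappa U_{\mathrm{O}}^m+(1-\kappa)U_{\mathrm{E}}^m$ with $\kappa=\frac{\lfloor v_1/2\rfloor}{v_1/2}\left(\lceil v_1/2\rceil-\frac{v_1}{2}\right)$ and $\lambda=\frac{\lfloor v_2/2\rfloor}{v_2/2}\left(\lceil v_2/2\rceil-\frac{v_2}{2}\right)$. Then $P^1(X,Y)=\frac{v_1}{2}-\lfloor v_2/2\rfloor$ and $P^2(Y,X)=\frac{v_2}{2}-\lfloor v_2/2\rfloor$. (ii) If $v_1/2=\lfloor v_2/2\rfloor+1$: $Y=U_{\mathrm{E}}^m$, and, with $\delta=\frac{2m+1}{m+1}$, $\sigma=\frac{2m+1}{m}$ and $\bar\alpha=\frac{\lceil v_2/2\rceil}{v_2/2}\left(\frac{v_2}{2}-\lfloor v_2/2\rfloor\right)$, either (a) $X=\lambda_{\mathrm{O}}\big((1-\alpha)U_{\mathrm{O}}^m+\alpha U_{\mathrm{O}}^{m+1}\big)+\lambda_{\mathrm{E}}\big((1-\alpha)U_{\mathrm{E}}^m+\alpha U_{\mathrm{O}}^{m+1}\big)+\sum_{j=1}^m\lambda_j\big(\alpha\delta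 V_j^m+(1-\alpha\delta)U_{\mathrm{O}}^m\big)+\sum_{j=1}^m\kappa_j\big(\alpha\delta V_j^m+(1-\alpha\delta)U_{\mathrm{E}}^m\big)$ with $\alpha\in[0,1/\delta]$, $\lambda_{\mathrm{O}},\lambda_{\mathrm{E}},\lambda_1,\dots,\lambda_m,\kappa_1,\dots,\kappa_m\ge0$, $\lambda_{\mathrm{O}}+\lambda_{\mathrm{E}}+\sum_{j=1}^m\lambda_j+\sum_{j=1}^m\kappa_j=1$, and $\lambda_{\mathrm{E}}+\sum_{j=1}^m\kappa_j\frac{1-\alpha\delta}{1-\alpha}=\frac{\bar\alpha}{1-\alpha}-\frac{\alpha}{1-\alpha}$; or (b) $X=\lambda_{\mathrm{O}}\big((1-\alpha)U_{\mathrm{O}}^m+\alpha U_{\mathrm{O}}^{m+1}\big)+\lambda_{\mathrm{E}}\big((1-\alpha)U_{\mathrm{E}}^m+\alpha U_{\mathrm{O}}^{m+1}\big)+\sum_{j=1}^m\lambda_j\big((1-\alpha)\sigma V_j^m+(1-(1-\alpha)\sigma)U_{\mathrm{O}}^{m+1}\big)$ with $\alpha\in(1/\delta,\bar\alpha]$, $\lambda_{\mathrm{O}},\lambda_{\mathrm{E}},\lambda_1,\dots,\lambda_m\ge0$, $\lambda_{\mathrm{O}}+\lambda_{\mathrm{E}}+\sum_{j=1}^m\lambda_j=1$, and $\lambda_{\mathrm{E}}=\frac{\bar\alpha}{1-\alpha}-\frac{\alpha}{1-\alpha}$. In this case $P^1(X,Y)=1$ and $P^2(Y,X)=1-\frac{v_2}{v_1}\alpha-\frac{v_1-v_2}{2}$.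 (iii) If $v_1/2>\lfloor v_2/2\rfloor+1$: $Y=\left(1-\frac bm\right)\delta_0+\frac bm U_{\mathrm{E}}^m$ with $b=\frac{\lfloor v_2/2\rfloor\lceil v_2/2\rceil}{v_1/2}$, and $X\in\mathrm{conv}\big(\{(1-\alpha)U_{\mathrm{O}}^m+\alpha U_{\mathrm{O}}^{m+1}\}\cup\mathcal{X}^{m,\alpha}\big)$ with $\alpha=\frac{\lceil v_2/2\rceil}{v_2/2}\left(\frac{v_2}{2}-\lfloor v_2/2\rfloor\right)$, where $\mathcal{X}^{m,\alpha}=\{\alpha\delta V_j^m+(1-\alpha\delta)U_{\mathrm{O}}^m: 1\le j\le m\}$ if $v_2/2\le\lceil v_2/2\rceil-\frac12$, and $\mathcal{X}^{m,\alpha}=\{(1-\alpha)\sigma V_j^m+(1-(1-\alpha)\sigma)U_{\mathrm{O}}^{m+1}:1\le j\le m\}$ if $v_2/2>\lceil v_2/2\rceil-\frac12$, with $\delta=\frac{2m+1}{m+1}$, $\sigma=\frac{2m+1}{m}$. In this case $P^1(X,Y)=v_1+1-2\lceil v_2/2\rceil$ and $P^2(Y,X)=0$.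
   Context: Discrete all-pay auction: two players, 1 and 2, value a prize at $v_1$ and $v_2$ respectively, where $v_1\ge v_2>0$. A (mixed) strategy is a probability distribution on $\mathbb{Z}_{\ge 0}$ with finite mean, identified with a $\mathbb{Z}_{\ge0}$-valued random variable; the two players' choices are independent. If player 1 uses $X$ and player 2 uses $Y$, the expected payoffs are $P^1(X,Y)=v_1\Pr(X>Y)+\frac{v_1}{2}\Pr(X=Y)-\mathbf{E}(X)$ and $P^2(Y,X)=v_2\Pr(Y>X)+\frac{v_2}{2}\Pr(X=Y)-\mathbf{E}(Y)$. A Nash equilibrium of the all-pay auction is a pair $(X,Y)$ with $P^1(X,Y)\ge P^1(X',Y)$ and $P^2(Y,X)\ge P^2(Y',X)$ for all strategies $X',Y'$. $\delta_j$ denotes the point mass at $j$; $\lambda A+(1-\lambda)B$ denotes the mixture of distributions $A$ and $B$ (similarly for longer convex combinations); $\mathrm{conv}$ denotes the set of all finite mixtures. Special distributions: for $m\ge1$, $U_{\mathrm{O}}^m$ is the uniform distribution on $\{1,3,\dots,2m-1\}$; for $m\ge0$, $U_{\mathrm{E}}^m$ is the uniform distribution on $\{0,2,\dots,2m\}$; for $m\ge1$ and $1\le j\le m$, $V_j^m=\sum_{i=1}^{j-1}\frac{2}{2m+1}\delta_{2i-1}+\frac{1}{2m+1}\delta_{2j-1}+\sum_{i=j}^{m}\frac{2}{2m+1}\delta_{2i}$. *)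

theory Defs
  imports "HOL-Probability.Probability"
begin

definition strategy :: "nat pmf \<Rightarrow> bool" where
  "strategy X \<longleftrightarrow> integrable (measure_pmf X) (\<lambda>n. real n)"

definition mean :: "nat pmf \<Rightarrow> real" where
  "mean X = measure_pmf.expectation X (\<lambda>n. real n)"

definition payoff :: "real \<Rightarrow> nat pmf \<Rightarrow> nat pmf \<Rightarrow> real" where
  "payoff v A B =
     v * measure_pmf.prob (pair_pmf A B) {(a, b). b < a}
   + v / 2 * measure_pmf.prob (pair_pmf A B) {(a, b). a = b}
   - mean A"

definition nash_eq :: "real \<Rightarrow> real \<Rightarrow> nat pmf \<Rightarrow> nat pmf \<Rightarrow> bool" where
  "nash_eq v1 v2 X Y \<longleftrightarrow>
     strategy X \<and> strategy Y \<and>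
     (\<forall>X'. strategy X' \<longrightarrow> payoff v1 X' Y \<le> payoff v1 X Y) \<and>
     (\<forall>Y'. strategy Y' \<longrightarrow> payoff v2 Y' X \<le> payoff v2 Y X)"

text \<open>Special distributions, given by their probability mass functions
  (mixtures of distributions are pointwise convex combinations of these).\<close>

definition dirac0 :: "nat \<Rightarrow> real" where
  "dirac0 n = (if n = 0 then 1 else 0)"

definition UO :: "nat \<Rightarrow> nat \<Rightarrow> real" where
  "UO m n = (if odd n \<and> n \<le> 2 * m - 1 then 1 / real m else 0)"

definition UE :: "nat \<Rightarrow> nat \<Rightarrow> real" where
  "UE m n = (if even n \<and> n \<le> 2 * m then 1 / real (m + 1) else 0)"

definition V :: "nat \<Rightarrow> nat \<Rightarrow> nat \<Rightarrow> real" where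
  "V m j n =
     (if odd n \<and> 1 \<le> n \<and> n + 2 \<le> 2 * j - 1 then 2 / real (2 * m + 1)
      else if n = 2 * j - 1 then 1 / real (2 * m + 1)
      else if even n \<and> 2 * j \<le> n \<and> n \<le> 2 * m then 2 / real (2 * m + 1)
      else 0)"

end

theory Submission
  imports Defs
begin

text \<open>
  Dividing each payoff by the player's valuation turns the auction into a zero-sum game up to terms
  depending on one player only. Equilibria are therefore interchangeable, and it suffices to find one
  equilibrium \<open>(X', Y')\<close> with \<open>X'\<close> of large support: every equilibrium strategy of a player is then
  optimal against the distinguished strategy of the other, which is a system of linear equations (on the
  support) and inequalities for its probabilities. In case (i) both distinguished strategies have
  support \<open>{0..2 * m}\<close>, and indifference on this set has a unique solution. In cases (ii) and (iii)
  the distinguished \<open>Y'\<close> lives on the even bids; the optimal \<open>X\<close> are the distributions whose even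
  probabilities are nondecreasing and whose remaining constraints say that \<open>X\<close> is a convex combination of
  \<open>UO m\<close>, \<open>UO (m + 1)\<close>, \<open>UE m\<close> and the \<open>V m j\<close> with one linear relation between the weights. A
  combination with positive weights serves as \<open>X'\<close> and forces \<open>Y = Y'\<close>.
\<close>

subsection \<open>Best responses and interchangeability\<close>

text \<open>The expected share of the prize for the pure bid \<open>n\<close> against
  \<open>B\<close>, a tie counting one half. Thus \<open>v * win B n - real n\<close> is the payoff
  of that bid, and all optimality conditions are stated through it.\<close>

definition win :: "nat pmf \<Rightarrow> nat \<Rightarrow> real" where
  "win B n = measure_pmf.prob B {..<n} + pmf B n / 2"

lemma prob_pair_pmf:
  "measure_pmf.prob (pair_pmf A B) S =
     measure_pmf.expectation A (\<lambda>a. measure_pmf.prob B {b. (a, b) \<in> S})"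
proof -
  have "emeasure (pair_pmf A B) S = (\<integral>\<^sup>+x. indicator S x \<partial>pair_pmf A B)"
    by simp
  also have "\<dots> = (\<integral>\<^sup>+a. \<integral>\<^sup>+b. indicator S (a, b) \<partial>B \<partial>A)"
    by (rule nn_integral_pair_pmf')
  also have "\<dots> = (\<integral>\<^sup>+a. emeasure B {b. (a, b) \<in> S} \<partial>A)"
  proof (rule nn_integral_cong)
    fix a
    have "(\<integral>\<^sup>+b. indicator S (a, b) \<partial>B) = (\<integral>\<^sup>+b. indicator {b. (a, b) \<in> S} b \<partial>B)"
      by (rule nn_integral_cong) (auto simp: indicator_def)
    then show "(\<integral>\<^sup>+b. indicator S (a, b) \<partial>B) = emeasure B {b. (a, b) \<in> S}"
      by simp
  qed
  also have "\<dots> = (\<integral>\<^sup>+a. ennreal (measure_pmf.prob B {b. (a, b) \<in> S}) \<partial>A)"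
    by (simp add: measure_pmf.emeasure_eq_measure)
  also have "\<dots> = ennreal (measure_pmf.expectation A (\<lambda>a. measure_pmf.prob B {b. (a, b) \<in> S}))"
    by (intro nn_integral_eq_integral measure_pmf.integrable_const_bound[where B = 1]) auto
  finally show ?thesis
    by (simp add: measure_pmf.emeasure_eq_measure integral_nonneg_AE)
qed

lemma win_eq_partial_sum: "win B n = (\<Sum>k<n. pmf B k) + pmf B n / 2"
  by (simp add: win_def measure_measure_pmf_finite)

lemma win_0: "win B 0 = pmf B 0 / 2"
  by (simp add: win_eq_partial_sum)

lemma win_Suc: "win B (Suc n) = win B n + (pmf B n + pmf B (Suc n)) / 2"
  by (simp add: win_eq_partial_sum field_simps)

lemma sum_pmf_eq_1:
  fixes B :: "nat pmf"
  assumes "\<And>n. n > N \<Longrightarrow> pmf B n = 0"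
  shows "(\<Sum>k\<le>N. pmf B k) = 1"
proof -
  have "set_pmf B \<subseteq> {..N}"
    using assms by (metis atMost_iff not_le set_pmf_iff subsetI)
  then show ?thesis
    by (intro sum_pmf_eq_1) auto
qed

lemma win_beyond:
  assumes "\<And>n. n > N \<Longrightarrow> pmf B n = 0" and "n > N"
  shows "win B n = 1"
proof -
  have "(\<Sum>k<n. pmf B k) = (\<Sum>k\<le>N. pmf B k)"
    using assms by (intro sum.mono_neutral_right) auto
  then show ?thesis
    using assms sum_pmf_eq_1[of N B] by (simp add: win_eq_partial_sum)
qed

text \<open>Conditioning on the own bid makes the payoff an average of pure payoffs, so only pure
  deviations have to be examined. The finite mean gives integrability of the cost of the bid; the
  other terms are bounded.\<close>

lemma payoff_eq_expectation:
  assumes "strategy A"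
  shows "integrable (measure_pmf A) (\<lambda>n. v * win B n - real n)"
    and "payoff v A B = measure_pmf.expectation A (\<lambda>n. v * win B n - real n)"
proof -
  have i1: "integrable (measure_pmf A) (\<lambda>n. measure_pmf.prob B {..<n})"
    by (intro measure_pmf.integrable_const_bound[where B = 1]) auto
  have i2: "integrable (measure_pmf A) (\<lambda>n. pmf B n)"
    by (intro measure_pmf.integrable_const_bound[where B = 1]) (auto simp: pmf_le_1)
  have i3: "integrable (measure_pmf A) (\<lambda>n. real n)"
    using assms by (simp add: strategy_def)
  show "integrable (measure_pmf A) (\<lambda>n. v * win B n - real n)"
    unfolding win_def using i1 i2 i3
    by (intro Bochner_Integration.integrable_diff integrable_mult_right
        Bochner_Integration.integrable_add) auto
  have "measure_pmf.expectation A (\<lambda>n. v * win B n - real n)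
      = v * (measure_pmf.expectation A (\<lambda>n. measure_pmf.prob B {..<n})
          + measure_pmf.expectation A (\<lambda>n. pmf B n) / 2) - mean A"
    unfolding win_def mean_def using i1 i2 i3
    by (subst Bochner_Integration.integral_diff) (auto intro!: integrable_mult_right)
  moreover have "measure_pmf.prob (pair_pmf A B) {(a, b). b < a}
      = measure_pmf.expectation A (\<lambda>n. measure_pmf.prob B {..<n})"
    by (subst prob_pair_pmf) (simp add: lessThan_def)
  moreover have "measure_pmf.prob (pair_pmf A B) {(a, b). a = b}
      = measure_pmf.expectation A (\<lambda>n. pmf B n)"
    by (subst prob_pair_pmf) (simp add: measure_pmf_single)
  ultimately show "payoff v A B = measure_pmf.expectation A (\<lambda>n. v * win B n - real n)"
    by (simp add: payoff_def field_simps)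
qed

lemma strategy_return: "strategy (return_pmf n)"
  by (simp add: strategy_def integrable_measure_pmf_finite)

lemma payoff_return: "payoff v (return_pmf n) B = v * win B n - real n"
  by (simp add: payoff_eq_expectation(2)[OF strategy_return])

lemma payoff_le:
  assumes "strategy A" "\<And>n. v * win B n - real n \<le> w"
  shows "payoff v A B \<le> w"
  unfolding payoff_eq_expectation(2)[OF assms(1)]
  by (rule measure_pmf.integral_le_const) (use assms payoff_eq_expectation(1) in auto)

lemma payoff_eq_const:
  assumes "strategy A" "\<And>n. n \<in> set_pmf A \<Longrightarrow> v * win B n - real n = w"
  shows "payoff v A B = w"
proof -
  have "measure_pmf.expectation A (\<lambda>n. v * win B n - real n) = measure_pmf.expectation A (\<lambda>_. w)"
    by (rule integral_cong_AE) (use assms in \<open>auto simp: AE_measure_pmf_iff\<close>)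
  then show ?thesis
    by (simp add: payoff_eq_expectation(2)[OF assms(1)])
qed

text \<open>Point masses are strategies, so no pure payoff exceeds the optimum. The shortfall of a
  bid is then nonnegative with expectation zero, hence zero at every atom of
  \<open>A\<close>.\<close>

lemma best_response_support:
  assumes "strategy A" "\<And>A'. strategy A' \<Longrightarrow> payoff v A' B \<le> payoff v A B"
  shows "v * win B n - real n \<le> payoff v A B"
    and "n \<in> set_pmf A \<Longrightarrow> v * win B n - real n = payoff v A B"
proof -
  show le: "v * win B n - real n \<le> payoff v A B" for n
    using assms(2)[OF strategy_return] by (simp add: payoff_return)
  let ?f = "\<lambda>n. payoff v A B - (v * win B n - real n)"
  have int: "integrable (measure_pmf A) (\<lambda>n. v * win B n - real n)"
    by (rule payoff_eq_expectation(1)[OF assms(1)])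
  have "measure_pmf.expectation A ?f = 0"
    using int by (simp add: payoff_eq_expectation(2)[OF assms(1)])
  then have "AE n in measure_pmf A. ?f n = 0"
    using int le by (subst (asm) integral_nonneg_eq_0_iff_AE) auto
  then show "n \<in> set_pmf A \<Longrightarrow> v * win B n - real n = payoff v A B"
    by (auto simp: AE_measure_pmf_iff)
qed

lemma nash_eqI:
  assumes "strategy X" "strategy Y"
    and "\<And>n. v1 * win Y n - real n \<le> w1"
    and "\<And>n. n \<in> set_pmf X \<Longrightarrow> v1 * win Y n - real n = w1"
    and "\<And>n. v2 * win X n - real n \<le> w2"
    and "\<And>n. n \<in> set_pmf Y \<Longrightarrow> v2 * win X n - real n = w2"
  shows "nash_eq v1 v2 X Y"
  unfolding nash_eq_def
  using assms by (simp add: payoff_le payoff_eq_const)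

lemma nash_eq_swap: "nash_eq v1 v2 X Y \<longleftrightarrow> nash_eq v2 v1 Y X"
  by (auto simp: nash_eq_def)

lemma nash_eqD:
  assumes "nash_eq v1 v2 X Y"
  shows "v1 * win Y n - real n \<le> payoff v1 X Y"
    and "n \<in> set_pmf X \<Longrightarrow> v1 * win Y n - real n = payoff v1 X Y"
    and "v2 * win X n - real n \<le> payoff v2 Y X"
    and "n \<in> set_pmf Y \<Longrightarrow> v2 * win X n - real n = payoff v2 Y X"
  using assms best_response_support[of X v1 Y] best_response_support[of Y v2 X]
  by (auto simp: nash_eq_def)

text \<open>Reads the equilibrium payoff off the opponent's strategy alone: a bid in the support of
  \<open>X\<close> earns at most \<open>w\<close>, and the deviation to \<open>k\<close> earns
  \<open>w\<close>.\<close>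

lemma nash_eq_payoff_unique:
  assumes "nash_eq v1 v2 X Y" "\<And>n. v1 * win Y n - real n \<le> w" "v1 * win Y k - real k = w"
  shows "payoff v1 X Y = w"
proof -
  obtain n where "n \<in> set_pmf X"
    using set_pmf_not_empty by fast
  then have "payoff v1 X Y \<le> w"
    using nash_eqD(2)[OF assms(1)] assms(2) by metis
  then show ?thesis
    using nash_eqD(1)[OF assms(1), of k] assms(3) by linarith
qed

text \<open>In units of the own valuation the two shares of the prize add up to 1, since winning,
  losing and tying partition the outcomes and a tie is split evenly.\<close>

lemma payoff_scaled_sum:
  assumes "u > 0" "v > 0"
  shows "payoff u A B / u + payoff v B A / v = 1 - mean A / u - mean B / v"
proof -
  let ?P = "measure_pmf.prob (pair_pmf A B)"
  have pre: "(\<lambda>(x, y). (y, x)) -` {(a, b). b < a} = {(a::nat, b). a < b}"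
    "(\<lambda>(x, y). (y, x)) -` {(a, b). a = b} = {(a::nat, b). a = b}"
    by auto
  have "measure_pmf.prob (pair_pmf B A) S = ?P ((\<lambda>(x, y). (y, x)) -` S)" for S
    unfolding pair_commute_pmf[of B A] by (rule measure_map_pmf)
  then have s: "measure_pmf.prob (pair_pmf B A) {(a, b). b < a} = ?P {(a, b). a < b}"
    "measure_pmf.prob (pair_pmf B A) {(a, b). a = b} = ?P {(a, b). a = b}"
    by (simp_all only: pre)
  have "?P (({(a, b). b < a} \<union> {(a, b). a = b}) \<union> {(a, b). a < b})
      = ?P ({(a, b). b < a} \<union> {(a, b). a = b}) + ?P {(a, b). a < b}"
    by (rule measure_pmf.finite_measure_Union) auto
  moreover have "?P ({(a, b). b < a} \<union> {(a, b). a = b})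
      = ?P {(a, b). b < a} + ?P {(a, b). a = b}"
    by (rule measure_pmf.finite_measure_Union) auto
  moreover have "{(a, b). b < a} \<union> {(a, b). a = b} \<union> {(a::nat, b). a < b} = UNIV"
    by auto
  ultimately have "?P {(a, b). b < a} + ?P {(a, b). a = b} + ?P {(a, b). a < b} = 1"
    by simp
  then show ?thesis
    using assms by (simp add: payoff_def s diff_divide_distrib add_divide_distrib)
qed

text \<open>After rescaling payoffs the game is zero-sum up to terms which each depend on one
  player's own bid only, so equilibrium strategies are interchangeable.\<close>

lemma nash_eq_interchange:
  assumes v: "v1 > 0" "v2 > 0" and "nash_eq v1 v2 X Y" "nash_eq v1 v2 X' Y'"
  shows "nash_eq v1 v2 X Y'"
proof -
  \<comment> \<open>\<open>G\<close> is the payoff function of a zero-sum game: up to a term fixed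
    by the opponent's strategy, player 1 maximises \<open>G\<close> and player 2 minimises
    it.\<close>
  define G where "G A B = payoff v1 A B / v1 + mean B / v2" for A B
  have G1: "payoff v1 A B = v1 * (G A B - mean B / v2)" for A B
    using v by (simp add: G_def)
  have G2: "payoff v2 B A = v2 * (1 - mean A / v1 - G A B)" for A B
  proof -
    have "payoff v2 B A / v2 = 1 - mean A / v1 - G A B"
      using payoff_scaled_sum[OF v, of A B] by (simp add: G_def)
    then show ?thesis
      using v by (metis less_irrefl nonzero_mult_div_cancel_left times_divide_eq_right)
  qed
  have S: "strategy X" "strategy Y" "strategy X'" "strategy Y'"
    using assms by (auto simp: nash_eq_def)
  have le: "G A Y \<le> G X Y" "G X Y \<le> G X B" "G A Y' \<le> G X' Y'" "G X' Y' \<le> G X' B"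
    if "strategy A" "strategy B" for A B
    using assms(3,4) that v unfolding nash_eq_def G1 G2 by auto
  \<comment> \<open>The chain of inequalities returns to its starting point, so all four values
    coincide.\<close>
  have "G X' Y \<le> G X Y" "G X Y \<le> G X Y'" "G X Y' \<le> G X' Y'" "G X' Y' \<le> G X' Y"
    using le S by blast+
  then have eq: "G X Y' = G X Y" "G X Y' = G X' Y'"
    by linarith+
  have "G A Y' \<le> G X Y'" "G X Y' \<le> G X B" if "strategy A" "strategy B" for A B
    using le[OF that] eq by simp_all
  then show ?thesis
    using S v unfolding nash_eq_def G1 G2 by auto
qed

lemma ex_pmf_finite_support:
  fixes f :: "nat \<Rightarrow> real"
  assumes "\<And>n. 0 \<le> f n" "\<And>n. n > N \<Longrightarrow> f n = 0" "(\<Sum>n\<le>N. f n) = 1"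
  shows "\<exists>P. strategy P \<and> (\<forall>n. pmf P n = f n)"
proof -
  have "(\<integral>\<^sup>+n. ennreal (f n) \<partial>count_space UNIV) = (\<Sum>n\<le>N. ennreal (f n))"
    using assms by (intro nn_integral_count_space') auto
  also have "\<dots> = 1"
    using assms by (simp add: sum_ennreal)
  finally have f: "pmf (embed_pmf f) n = f n" for n
    using assms by (intro pmf_embed_pmf) auto
  then have "set_pmf (embed_pmf f) \<subseteq> {..N}"
    using assms(2) by (metis atMost_iff not_le set_pmf_iff subsetI)
  then have "strategy (embed_pmf f)"
    unfolding strategy_def by (intro integrable_measure_pmf_finite) (simp add: finite_subset)
  with f show ?thesis
    by auto
qed

subsection \<open>Mixtures of the special distributions\<close>

lemma UO_even: "UO m (2 * k) = 0"
  by (simp add: UO_def)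

lemma UO_odd: "UO m (2 * k + 1) = (if k < m then 1 / real m else 0)"
  by (auto simp: UO_def)

lemma UE_even: "UE m (2 * k) = (if k \<le> m then 1 / real (m + 1) else 0)"
  by (auto simp: UE_def)

lemma UE_odd: "UE m (2 * k + 1) = 0"
  by (simp add: UE_def)

lemma V_even:
  assumes "1 \<le> j" "k \<le> m"
  shows "V m j (2 * k) = (if j \<le> k then 2 / real (2 * m + 1) else 0)"
proof -
  have "2 * k \<noteq> 2 * j - 1"
    using assms by presburger
  then show ?thesis
    using assms by (simp add: V_def)
qed

lemma V_odd:
  assumes "1 \<le> j"
  shows "V m j (2 * k + 1) =
    (if k + 1 < j then 2 else if k + 1 = j then 1 else 0) / real (2 * m + 1)"
proof -
  have "2 * k + 1 + 2 \<le> 2 * j - 1 \<longleftrightarrow> k + 1 < j" "2 * k + 1 = 2 * j - 1 \<longleftrightarrow> k + 1 = j"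
    using assms by auto
  then show ?thesis
    by (simp add: V_def)
qed

text \<open>Common normal form for player 1's strategies in cases (ii) and (iii): the nested convex
  combinations of the theorem are multiplied out into these four kinds of weights.\<close>

definition mixture :: "nat \<Rightarrow> real \<Rightarrow> real \<Rightarrow> real \<Rightarrow> (nat \<Rightarrow> real) \<Rightarrow> nat \<Rightarrow> real" where
  "mixture m p q r c n =
     p * UO m n + q * UO (m + 1) n + r * UE m n + (\<Sum>j=1..m. c j * V m j n)"

text \<open>Among the ingredients only \<open>UE m\<close> and the \<open>V m j\<close> with
  \<open>j \<le> k\<close> charge the bid \<open>2 * k\<close>. Hence \<open>c k\<close> is visible
  as the jump of the even probabilities from \<open>2 * k - 2\<close> to
  \<open>2 * k\<close>.\<close>

lemma mixture_even:
  assumes "k \<le> m"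
  shows "mixture m p q r c (2 * k) = r / real (m + 1) + 2 / real (2 * m + 1) * (\<Sum>j=1..k. c j)"
proof -
  have "(\<Sum>j=1..m. c j * V m j (2 * k)) = (\<Sum>j=1..m. if j \<le> k then c j * (2 / real (2 * m + 1)) else 0)"
    using assms by (intro sum.cong) (auto simp: V_even)
  also have "\<dots> = (\<Sum>j\<in>{1..m} \<inter> {j. j \<le> k}. c j * (2 / real (2 * m + 1)))"
    by (simp add: sum.If_cases)
  also have "{1..m} \<inter> {j. j \<le> k} = {1..k}"
    using assms by auto
  also have "(\<Sum>j=1..k. c j * (2 / real (2 * m + 1))) = 2 / real (2 * m + 1) * (\<Sum>j=1..k. c j)"
    by (subst sum_distrib_left) (auto intro!: sum.cong)
  finally show ?thesis
    using assms by (simp add: mixture_def UO_even UE_even)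
qed

text \<open>The left side is twice the increase of \<open>win\<close> from \<open>2 * k\<close> to
  \<open>2 * k + 2\<close>. It is independent of \<open>k\<close> for each ingredient separately,
  with value \<open>2 / m\<close> for \<open>UO m\<close>, \<open>2 / (m + 1)\<close> for
  \<open>UO (m + 1)\<close> and \<open>UE m\<close>, and \<open>4 / (2 * m + 1)\<close> for
  \<open>V m j\<close>.\<close>

lemma mixture_even_odd_even:
  assumes "k < m"
  shows "mixture m p q r c (2 * k) + 2 * mixture m p q r c (2 * k + 1) + mixture m p q r c (2 * k + 2)
    = 2 * (p / real m + (q + r) / real (m + 1) + 2 * (\<Sum>j=1..m. c j) / real (2 * m + 1))"
proof -
  have V: "V m j (2 * k) + 2 * V m j (2 * k + 1) + V m j (2 * (k + 1)) = 4 / real (2 * m + 1)"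
    if "j \<in> {1..m}" for j
  proof -
    have *: "V m j (2 * k) = (if j \<le> k then 2 / real (2 * m + 1) else 0)"
      "V m j (2 * (k + 1)) = (if j \<le> k + 1 then 2 / real (2 * m + 1) else 0)"
      using V_even[of j k m] V_even[of j "k + 1" m] that assms by auto
    show ?thesis
      unfolding * using V_odd[of j m k] that by (auto simp: add_divide_distrib[symmetric])
  qed
  have "(\<Sum>j=1..m. c j * V m j (2 * k)) + 2 * (\<Sum>j=1..m. c j * V m j (2 * k + 1))
       + (\<Sum>j=1..m. c j * V m j (2 * (k + 1)))
     = (\<Sum>j=1..m. c j * (V m j (2 * k) + 2 * V m j (2 * k + 1) + V m j (2 * (k + 1))))"
    unfolding sum_distrib_left sum.distrib[symmetric]
    by (intro sum.cong) (auto simp: algebra_simps)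
  also have "\<dots> = (\<Sum>j=1..m. c j * (4 / real (2 * m + 1)))"
    using V by (intro sum.cong) auto
  also have "\<dots> = 4 * (\<Sum>j=1..m. c j) / real (2 * m + 1)"
    by (subst sum_distrib_right[symmetric]) simp
  finally have sumV: "(\<Sum>j=1..m. c j * V m j (2 * k)) + 2 * (\<Sum>j=1..m. c j * V m j (2 * k + 1))
       + (\<Sum>j=1..m. c j * V m j (2 * (k + 1))) = 4 * (\<Sum>j=1..m. c j) / real (2 * m + 1)" .
  have "mixture m p q r c (2 * k) + 2 * mixture m p q r c (2 * k + 1) + mixture m p q r c (2 * (k + 1))
     = p * (UO m (2 * k) + 2 * UO m (2 * k + 1) + UO m (2 * (k + 1)))
     + q * (UO (m + 1) (2 * k) + 2 * UO (m + 1) (2 * k + 1) + UO (m + 1) (2 * (k + 1)))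
     + r * (UE m (2 * k) + 2 * UE m (2 * k + 1) + UE m (2 * (k + 1)))
     + 4 * (\<Sum>j=1..m. c j) / real (2 * m + 1)"
    unfolding sumV[symmetric] mixture_def by (simp add: algebra_simps)
  then show ?thesis
    using assms unfolding UO_even UO_odd UE_even UE_odd
    by (simp add: add_divide_distrib algebra_simps)
qed

lemma mixture_last: "mixture m p q r c (2 * m + 1) = q / real (m + 1)"
proof -
  have "(\<Sum>j=1..m. c j * V m j (2 * m + 1)) = 0"
    unfolding V_def by (intro sum.neutral) auto
  then show ?thesis
    unfolding mixture_def UO_odd UE_odd by simp
qed

lemma mixture_beyond: "mixture m p q r c n = 0" if "n > 2 * m + 1"
  using that unfolding mixture_def UO_def UE_def V_def by (auto intro!: sum.neutral)

lemma mixture_nonneg: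
  assumes "0 \<le> p" "0 \<le> q" "0 \<le> r" "\<And>j. j \<in> {1..m} \<Longrightarrow> 0 \<le> c j"
  shows "0 \<le> mixture m p q r c n"
  unfolding mixture_def using assms
  by (intro add_nonneg_nonneg sum_nonneg mult_nonneg_nonneg) (auto simp: UO_def UE_def V_def)

text \<open>Adding the first \<open>k\<close> relations counts every term twice, except the two end
  terms, which are counted once.\<close>

lemma sum_atMost_even:
  fixes f :: "nat \<Rightarrow> real"
  assumes "\<And>k. k < m \<Longrightarrow> f (2 * k) + 2 * f (2 * k + 1) + f (2 * k + 2) = 2 * K" "k \<le> m"
  shows "(\<Sum>n\<le>2 * k. f n) = (f 0 + f (2 * k)) / 2 + real k * K"
  using assms(2)
proof (induction k)
  case (Suc k)
  then show ?case
    using assms(1)[of k] by (simp add: field_simps)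
qed simp

lemma sum_mixture: "(\<Sum>n\<le>2 * m + 1. mixture m p q r c n) = p + q + r + (\<Sum>j=1..m. c j)" if "m > 0"
proof -
  define C where "C = (\<Sum>j=1..m. c j)"
  have e: "mixture m p q r c 0 = r / real (m + 1)"
    "mixture m p q r c (2 * m) = r / real (m + 1) + 2 / real (2 * m + 1) * C"
    using mixture_even[of 0 m p q r c] mixture_even[of m m p q r c] by (simp_all add: C_def)
  have "(\<Sum>n\<le>2 * m. mixture m p q r c n) = (mixture m p q r c 0 + mixture m p q r c (2 * m)) / 2
      + real m * (p / real m + (q + r) / real (m + 1) + 2 * C / real (2 * m + 1))"
    by (rule sum_atMost_even[where m = m]) (simp_all only: mixture_even_odd_even C_def)
  then have "(\<Sum>n\<le>2 * m + 1. mixture m p q r c n) = (mixture m p q r c 0 + mixture m p q r c (2 * m)) / 2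
      + real m * (p / real m + (q + r) / real (m + 1) + 2 * C / real (2 * m + 1)) + q / real (m + 1)"
    using mixture_last[of m p q r c] by simp
  also have "\<dots> = p + q + r + C"
  proof -
    \<comment> \<open>With the quotients abbreviated, what remains is linear arithmetic.\<close>
    define x y where "x = (q + r) / real (m + 1)" and "y = C / real (2 * m + 1)"
    have "x * real (m + 1) = q + r" "y * real (2 * m + 1) = C"
      by (simp_all only: x_def y_def) simp_all
    then have "real m * x + x = q + r" "2 * real m * y + y = C"
      by (simp_all add: algebra_simps)
    moreover have "r / real (m + 1) + q / real (m + 1) = x" "2 / real (2 * m + 1) * C = 2 * y"
      by (simp_all add: x_def y_def add_divide_distrib)
    moreover have "real m * (p / real m + x + 2 * C / real (2 * m + 1)) = p + real m * x + 2 * real m * y"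
      using that by (simp add: distrib_left y_def)
    ultimately show ?thesis
      unfolding e x_def[symmetric] by argo
  qed
  finally show ?thesis
    by (simp add: C_def)
qed

lemma ex_pmf_mixture:
  assumes "m > 0" "0 \<le> p" "0 \<le> q" "0 \<le> r" "\<And>j. j \<in> {1..m} \<Longrightarrow> 0 \<le> c j"
    "p + q + r + (\<Sum>j=1..m. c j) = 1"
  shows "\<exists>X. strategy X \<and> (\<forall>n. pmf X n = mixture m p q r c n)"
proof (rule ex_pmf_finite_support[where N = "2 * m + 1"])
  show "(\<Sum>n\<le>2 * m + 1. mixture m p q r c n) = 1"
    using assms by (simp only: sum_mixture)
qed (use assms in \<open>auto intro: mixture_nonneg mixture_beyond\<close>)

text \<open>For slope \<open>K = 1 / b\<close> this makes all even bids up to \<open>2 * m\<close>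
  equally good at valuation \<open>2 * b\<close>.\<close>

lemma win_even:
  assumes "\<And>k. k < m \<Longrightarrow> pmf B (2 * k) + 2 * pmf B (2 * k + 1) + pmf B (2 * k + 2) = 2 * K" "k \<le> m"
  shows "win B (2 * k) = pmf B 0 / 2 + real k * K"
proof -
  have "(\<Sum>n\<le>2 * k. pmf B n) = (\<Sum>n<2 * k. pmf B n) + pmf B (2 * k)"
    by (simp add: lessThan_Suc_atMost[symmetric])
  moreover have "(\<Sum>n\<le>2 * k. pmf B n) = (pmf B 0 + pmf B (2 * k)) / 2 + real k * K"
    using assms by (rule sum_atMost_even)
  ultimately show ?thesis
    by (simp add: win_eq_partial_sum add_divide_distrib)
qed

subsection \<open>Half-valuations with different integer parts\<close>

lemma bid_cases:
  fixes m n :: nat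
  obtains k where "n = 2 * k" "k \<le> m"
  | k where "n = 2 * k + 1" "k < m"
  | "n = 2 * m + 1"
  | "n > 2 * m + 1"
proof -
  consider "n > 2 * m + 1" | "n = 2 * m + 1" | "n \<le> 2 * m" "even n" | "n \<le> 2 * m" "odd n"
    by linarith
  then show ?thesis
  proof cases
    case 3
    then show ?thesis using that(1)[of "n div 2"] by auto
  next
    case 4
    then have "n = 2 * (n div 2) + 1" "n div 2 < m"
      by presburger+
    then show ?thesis by (rule that(2))
  qed (use that in auto)
qed

text \<open>The parameters \<open>a\<close> and \<open>b\<close> stand for half the valuations, \<open>v1 / 2\<close> and \<open>v2 / 2\<close>.\<close>

locale auction =
  fixes m :: nat and b :: real
  assumes m_pos: "m > 0" and b_gt: "real m < b" and b_less: "b < real m + 1"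
begin

lemma b_pos: "b > 0"
  using m_pos b_gt by simp

text \<open>Weights of a probability distribution with one further equation: the slope of
  \<open>win\<close> along the even bids is \<open>1 / b\<close>, that is, player 2 is indifferent
  between them.\<close>

definition admissible :: "real \<Rightarrow> real \<Rightarrow> real \<Rightarrow> (nat \<Rightarrow> real) \<Rightarrow> bool" where
  "admissible p q r c \<longleftrightarrow>
     0 \<le> p \<and> 0 \<le> q \<and> 0 \<le> r \<and> (\<forall>j\<in>{1..m}. 0 \<le> c j) \<and>
     p + q + r + (\<Sum>j=1..m. c j) = 1 \<and>
     p / real m + (q + r) / real (m + 1) + 2 * (\<Sum>j=1..m. c j) / real (2 * m + 1) = 1 / b"

lemma admissible_mixture_pairs:
  assumes "admissible p q r c" "k < m"
  shows "mixture m p q r c (2 * k) + 2 * mixture m p q r c (2 * k + 1) + mixture m p q r c (2 * k + 2)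
    = 2 * (1 / b)"
  using assms by (simp only: mixture_even_odd_even admissible_def)

section \<open>Payoffs of player 2 against an admissible mixture\<close>

context
  fixes X p q r c
  assumes adm: "admissible p q r c" and X: "\<And>n. pmf X n = mixture m p q r c n"
begin

lemma payoff_against_mixture_even:
  assumes "k \<le> m"
  shows "2 * b * win X (2 * k) - real (2 * k) = b * r / real (m + 1)"
proof -
  have w: "win X (2 * k) = pmf X 0 / 2 + real k * (1 / b)"
    using admissible_mixture_pairs[OF adm] assms by (intro win_even) (simp_all only: X)
  have x0: "b * r / real (m + 1) = b * pmf X 0"
    using mixture_even[of 0 m p q r c] by (simp add: X)
  show ?thesis
    unfolding w x0 using b_pos by (simp add: field_simps)
qed

text \<open>Stopping halfway between two equally good even bids costs in proportion to the jump of
  the even probabilities between them, and that jump comes from \<open>c (k + 1)\<close>.\<close>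

lemma payoff_against_mixture_odd:
  assumes "k < m"
  shows "2 * b * win X (2 * k + 1) - real (2 * k + 1)
    = b * r / real (m + 1) - b * c (k + 1) / real (2 * m + 1)"
proof -
  have "mixture m p q r c (2 * (k + 1)) = mixture m p q r c (2 * k) + 2 * c (k + 1) / real (2 * m + 1)"
    using assms mixture_even[of k m p q r c] mixture_even[of "k + 1" m p q r c]
    by (simp add: distrib_left)
  then have "mixture m p q r c (2 * k + 2) = mixture m p q r c (2 * k) + 2 * c (k + 1) / real (2 * m + 1)"
    by simp
  then have "pmf X (2 * k) + pmf X (2 * k + 1) = 1 / b - c (k + 1) / real (2 * m + 1)"
    using admissible_mixture_pairs[OF adm assms] unfolding X by linarith
  then have *: "win X (2 * k + 1) = win X (2 * k) + (1 / b - c (k + 1) / real (2 * m + 1)) / 2"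
    using win_Suc[of X "2 * k"] by simp
  have "2 * b * win X (2 * k + 1) = 2 * b * win X (2 * k) + (1 - b * c (k + 1) / real (2 * m + 1))"
    unfolding * using b_pos by (simp add: distrib_left right_diff_distrib)
  then show ?thesis
    using payoff_against_mixture_even[of k] assms by simp
qed

text \<open>The probabilities of \<open>2 * m\<close> and \<open>2 * m + 1\<close> contain every
  term of the slope equation except \<open>p / real m\<close>, which therefore measures the
  loss.\<close>

lemma payoff_against_mixture_last:
  "2 * b * win X (2 * m + 1) - real (2 * m + 1) = b * r / real (m + 1) - b * p / real m"
proof -
  have "pmf X (2 * m) + pmf X (2 * m + 1) = 1 / b - p / real m"
    using adm mixture_even[of m m p q r c] mixture_last[of m p q r c]
    by (simp add: X admissible_def add_divide_distrib)
  then have *: "win X (2 * m + 1) = win X (2 * m) + (1 / b - p / real m) / 2"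
    using win_Suc[of X "2 * m"] by simp
  have "2 * b * win X (2 * m + 1) = 2 * b * win X (2 * m) + (1 - b * p / real m)"
    unfolding * using b_pos by (simp add: distrib_left right_diff_distrib)
  then show ?thesis
    using payoff_against_mixture_even[of m] by simp
qed

text \<open>Such a bid wins for certain but is at least \<open>2 * m + 2\<close>, which exceeds the
  valuation \<open>2 * b\<close>; the level on the right is nonnegative.\<close>

lemma payoff_against_mixture_beyond:
  assumes "n > 2 * m + 1"
  shows "2 * b * win X n - real n < b * r / real (m + 1)"
proof -
  have "win X n = 1"
    using assms by (intro win_beyond[where N = "2 * m + 1"]) (auto simp: X mixture_beyond)
  moreover have "0 \<le> b * r / real (m + 1)"
    using adm b_pos by (simp add: admissible_def)
  ultimately show ?thesis
    using assms b_less by simp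
qed

lemma payoff_against_mixture_le: "2 * b * win X n - real n \<le> b * r / real (m + 1)"
proof (cases rule: bid_cases[of n m])
  case (1 k)
  then show ?thesis using payoff_against_mixture_even[of k] by simp
next
  case (2 k)
  then have "0 \<le> b * c (k + 1) / real (2 * m + 1)"
    using adm b_pos by (auto simp: admissible_def)
  then show ?thesis using payoff_against_mixture_odd[of k] 2 by simp
next
  case 3
  have "0 \<le> b * p / real m"
    using adm b_pos by (simp add: admissible_def)
  then show ?thesis using payoff_against_mixture_last 3 by simp
next
  case 4
  then show ?thesis using payoff_against_mixture_beyond[of n] by simp
qed

text \<open>Positive weights make every loss at an odd bid strict. This confines player 2 to the
  even bids when such a mixture is played.\<close>

lemma payoff_against_positive_mixture_eq:
  assumes "p > 0" "\<And>j. j \<in> {1..m} \<Longrightarrow> c j > 0" "2 * b * win X n - real n = b * r / real (m + 1)"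
  shows "even n \<and> n \<le> 2 * m"
proof (cases rule: bid_cases[of n m])
  case (2 k)
  then have "0 < b * c (k + 1) / real (2 * m + 1)"
    using assms(2) b_pos by auto
  then have False
    using payoff_against_mixture_odd[OF 2(2)] assms(3) unfolding 2(1) by linarith
  then show ?thesis ..
next
  case 3
  have "0 < b * p / real m"
    using assms(1) b_pos m_pos by simp
  then have False
    using payoff_against_mixture_last assms(3) unfolding 3 by linarith
  then show ?thesis ..
next
  case 4
  then show ?thesis using payoff_against_mixture_beyond[of n] assms(3) by simp
qed auto

end

text \<open>Clearing \<open>real m\<close> and \<open>real (m + 1)\<close> and eliminating
  \<open>p\<close> by the total mass leaves an equation whose right side is the constant
  \<open>\<alpha>\<close> bar of the theorem.\<close>

lemma admissible_fraction:
  assumes "p + q + r + C = (1::real)"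
  shows "p / real m + (q + r) / real (m + 1) + 2 * C / real (2 * m + 1) = 1 / b
    \<longleftrightarrow> q + r + C * real (m + 1) / real (2 * m + 1) = real (m + 1) / b * (b - real m)"
proof -
  define M where "M = real m"
  have M: "M > 0" "real (m + 1) = M + 1" "real (2 * m + 1) = 2 * M + 1"
    using m_pos by (simp_all add: M_def)
  define d where "d = C / (2 * M + 1)"
  define e where "e = (q + r) / (M + 1)"
  have C: "C = d * (2 * M + 1)" and qr: "q + r = e * (M + 1)"
    using M by (simp_all add: d_def e_def)
  have p: "p = 1 - e * (M + 1) - d * (2 * M + 1)"
    using assms C qr by simp
  have "p / M + e + 2 * d = 1 / b \<longleftrightarrow> M * (p / M + e + 2 * d) * (M + 1) = M * (1 / b) * (M + 1)"
    using M by (simp only: mult_cancel_left mult_cancel_right) auto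
  also have "M * (p / M + e + 2 * d) * (M + 1) = (M + 1) * (1 - e - d)"
    using M unfolding p by (simp add: field_simps)
  also have "(M + 1) * (1 - e - d) = M * (1 / b) * (M + 1)
      \<longleftrightarrow> (M + 1) * (e + d) = (M + 1) / b * (b - M)"
    using b_pos by (auto simp: field_simps)
  also have "(M + 1) * (e + d) = q + r + d * (M + 1)"
    by (simp add: qr algebra_simps)
  finally show ?thesis
    unfolding M M_def[symmetric] d_def e_def by (simp add: ac_simps)
qed

end

section \<open>Player 2's distinguished strategy and the payoffs of player 1 against it\<close>

definition weak_strategy :: "nat \<Rightarrow> real \<Rightarrow> nat \<Rightarrow> real" where
  "weak_strategy m a n =
     (if n = 0 then 1 - real m / a else if even n \<and> n \<le> 2 * m then 1 / a else 0)"

lemma sum_weak_strategy: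
  assumes "k \<le> m"
  shows "(\<Sum>n\<le>2 * k. weak_strategy m a n) = 1 - real m / a + real k / a"
  using assms
proof (induction k)
  case (Suc k)
  have "weak_strategy m a (Suc (2 * k)) = 0" "weak_strategy m a (Suc (Suc (2 * k))) = 1 / a"
    using Suc.prems by (auto simp: weak_strategy_def)
  then show ?case
    using Suc by (simp add: add_divide_distrib)
qed (simp add: weak_strategy_def)

lemma ex_pmf_weak_strategy:
  assumes "a > 0" "real m \<le> a"
  shows "\<exists>Y. strategy Y \<and> (\<forall>n. pmf Y n = weak_strategy m a n)"
proof (rule ex_pmf_finite_support[where N = "2 * m"])
  show "(\<Sum>n\<le>2 * m. weak_strategy m a n) = 1"
    by (simp add: sum_weak_strategy)
qed (use assms in \<open>auto simp: weak_strategy_def\<close>)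

text \<open>From bid 1 to bid \<open>2 * m + 1\<close> any two consecutive probabilities add up to
  \<open>1 / a\<close>, so a further unit of bid raises the expected prize by exactly 1. Beyond that
  range winning is already certain.\<close>

lemma
  assumes a: "a > 0" and Y: "\<And>n. pmf Y n = weak_strategy m a n"
  shows payoff_against_weak_0: "2 * a * win Y 0 - real 0 = a - real m"
    and payoff_against_weak_inner:
      "1 \<le> n \<Longrightarrow> n \<le> 2 * m + 1 \<Longrightarrow> 2 * a * win Y n - real n = 2 * a - 2 * real m - 1"
    and payoff_against_weak_outer:
      "n > 2 * m + 1 \<Longrightarrow> 2 * a * win Y n - real n < 2 * a - 2 * real m - 1"
proof -
  show "2 * a * win Y 0 - real 0 = a - real m"
    using a by (simp add: win_0 Y weak_strategy_def field_simps)
  have "2 * a * win Y (Suc n) - real (Suc n) = 2 * a - 2 * real m - 1" if "n < 2 * m + 1" for n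
    using that
  proof (induction n)
    case 0
    have "win Y (Suc 0) = 1 - real m / a"
      by (simp add: win_Suc win_0 Y weak_strategy_def)
    then show ?case
      using a by (simp add: field_simps)
  next
    case (Suc n)
    then have "pmf Y (Suc n) + pmf Y (Suc (Suc n)) = 1 / a"
      by (auto simp: Y weak_strategy_def)
    then have "2 * a * win Y (Suc (Suc n)) = 2 * a * win Y (Suc n) + 1"
      using a win_Suc[of Y "Suc n"] by (simp add: field_simps)
    then show ?case
      using Suc by simp
  qed
  then show "1 \<le> n \<Longrightarrow> n \<le> 2 * m + 1 \<Longrightarrow> 2 * a * win Y n - real n = 2 * a - 2 * real m - 1"
    by (cases n) auto
  assume n: "n > 2 * m + 1"
  then have "win Y n = 1"
    by (intro win_beyond[where N = "2 * m"]) (auto simp: Y weak_strategy_def)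
  then show "2 * a * win Y n - real n < 2 * a - 2 * real m - 1"
    using n by simp
qed

text \<open>Bid 0 earns \<open>a - m\<close>, which exceeds the common level of the bids from 1 to
  \<open>2 * m + 1\<close> only when \<open>a < m + 1\<close>; at \<open>a = m + 1\<close> the two
  are equal.\<close>

lemma payoff_against_weak_le:
  assumes "a \<ge> real m + 1" "\<And>n. pmf Y n = weak_strategy m a n"
  shows "2 * a * win Y n - real n \<le> 2 * a - 2 * real m - 1"
proof -
  have "a > 0"
    using assms(1) by linarith
  note Y = payoff_against_weak_0[OF this assms(2)] payoff_against_weak_inner[OF this assms(2), of n]
    payoff_against_weak_outer[OF this assms(2), of n]
  consider "n = 0" | "1 \<le> n" "n \<le> 2 * m + 1" | "n > 2 * m + 1"
    by linarith
  then show ?thesis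
    using Y assms(1) by cases auto
qed

section \<open>All equilibria for \<open>a \<ge> real m + 1\<close>\<close>

context auction
begin

text \<open>Above the boundary \<open>a = m + 1\<close> bid 0 is strictly worse for player 1, and
  \<open>r\<close> is the only weight that charges it, hence the condition on
  \<open>r\<close>.\<close>

lemma nash_eq_mixture_weak:
  assumes a: "a \<ge> real m + 1" and Y: "\<And>n. pmf Y n = weak_strategy m a n"
    and str: "strategy X" "strategy Y"
    and adm: "admissible p q r c" and X: "\<And>n. pmf X n = mixture m p q r c n"
    and r: "a > real m + 1 \<Longrightarrow> r = 0"
  shows "nash_eq (2 * a) (2 * b) X Y"
proof (rule nash_eqI[where ?w1.0 = "2 * a - 2 * real m - 1" and ?w2.0 = "b * r / real (m + 1)"])
  have a_pos: "a > 0"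
    using a by linarith
  fix n
  show "2 * a * win Y n - real n \<le> 2 * a - 2 * real m - 1"
    by (rule payoff_against_weak_le[OF a Y])
  show "2 * b * win X n - real n \<le> b * r / real (m + 1)"
    by (rule payoff_against_mixture_le[OF adm X])
  show "2 * a * win Y n - real n = 2 * a - 2 * real m - 1" if "n \<in> set_pmf X"
  proof -
    have nz: "mixture m p q r c n \<noteq> 0"
      using that by (simp add: set_pmf_iff X)
    then have "n \<le> 2 * m + 1"
      using mixture_beyond[of m n p q r c] by force
    moreover have "a = real m + 1" if "n = 0"
      using nz mixture_even[of 0 m p q r c] that r a by force
    ultimately show ?thesis
      using payoff_against_weak_0[OF a_pos Y] payoff_against_weak_inner[OF a_pos Y, of n]
      by (cases "n = 0") auto
  qed
  show "2 * b * win X n - real n = b * r / real (m + 1)" if "n \<in> set_pmf Y"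
  proof -
    have "even n" "n \<le> 2 * m"
      using that by (auto simp: set_pmf_iff Y weak_strategy_def split: if_splits)
    then obtain k where "n = 2 * k" "k \<le> m"
      by auto
    then show ?thesis
      using payoff_against_mixture_even[OF adm X, of k] by simp
  qed
qed (use str in auto)

text \<open>All even bids up to \<open>2 * m\<close> lie in the support of \<open>Y\<close>. Player
  2's indifference there gives one equation for each \<open>k < m\<close>, and the absence of a
  profitable odd bid gives inequalities; these are exactly the conditions for reading off
  nonnegative weights.\<close>

lemma nash_eq_weak_imp_mixture:
  assumes a: "a \<ge> real m + 1" and Y: "\<And>n. pmf Y n = weak_strategy m a n"
    and nash: "nash_eq (2 * a) (2 * b) X Y"
  shows "\<exists>p q r c. admissible p q r c \<and> (a > real m + 1 \<longrightarrow> r = 0) \<and>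
    (\<forall>n. pmf X n = mixture m p q r c n)"
proof -
  have a_pos: "a > 0" and "a > real m"
    using a by linarith+
  note weak_0 = payoff_against_weak_0[OF a_pos Y]
  note weak_inner = payoff_against_weak_inner[OF a_pos Y]
  note weak_outer = payoff_against_weak_outer[OF a_pos Y]
  define x where "x = pmf X"
  have x_nonneg: "x n \<ge> 0" for n
    by (simp add: x_def)
  have w1: "payoff (2 * a) X Y = 2 * a - 2 * real m - 1"
    using payoff_against_weak_le[OF a Y] weak_inner[of 1] by (intro nash_eq_payoff_unique[OF nash, of _ 1]) auto
  have supp: "2 * a * win Y n - real n = 2 * a - 2 * real m - 1" if "x n \<noteq> 0" for n
    using nash_eqD(2)[OF nash, of n] that w1 by (simp add: set_pmf_iff x_def)
  have x_beyond: "x n = 0" if "n > 2 * m + 1" for n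
    using supp[of n] weak_outer[OF that] by auto
  have x_0: "x 0 = 0" if "a > real m + 1"
    using supp[of 0] weak_0 that by auto
  define w2 where "w2 = payoff (2 * b) Y X"
  have even: "2 * b * win X (2 * k) - real (2 * k) = w2" if "k \<le> m" for k
  proof -
    have "2 * k \<in> set_pmf Y"
      using that a_pos \<open>a > real m\<close> by (auto simp: set_pmf_iff Y weak_strategy_def)
    then show ?thesis
      unfolding w2_def by (rule nash_eqD(4)[OF nash])
  qed
  have le: "2 * b * win X n - real n \<le> w2" for n
    unfolding w2_def by (rule nash_eqD(3)[OF nash])
  have win1: "2 * b * win X (2 * k + 1) = 2 * b * win X (2 * k) + b * (x (2 * k) + x (2 * k + 1))" for k
    by (simp add: win_Suc x_def algebra_simps)
  have win2: "2 * b * win X (2 * (k + 1)) = 2 * b * win X (2 * k + 1) + b * (x (2 * k + 1) + x (2 * k + 2))" for k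
    by (simp add: win_Suc x_def algebra_simps)
  have pairs_b: "b * (x (2 * k) + 2 * x (2 * k + 1) + x (2 * k + 2)) = 2" if "k < m" for k
    using even[of k] even[of "k + 1"] win1[of k] win2[of k] that by (simp add: algebra_simps)
  have pairs: "x (2 * k) + 2 * x (2 * k + 1) + x (2 * k + 2) = 2 * (1 / b)" if "k < m" for k
    using pairs_b[OF that] b_pos by (simp add: field_simps)
  have odd_b: "b * (x (2 * k) + x (2 * k + 1)) \<le> 1" if "k \<le> m" for k
    using even[OF that] le[of "2 * k + 1"] win1[of k] by simp
  have odd: "x (2 * k) + x (2 * k + 1) \<le> 1 / b" if "k \<le> m" for k
    using odd_b[OF that] b_pos by (simp add: field_simps)
  \<comment> \<open>By the pair equation, the bound on the first two probabilities says that the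
    even probabilities do not decrease.\<close>
  have mono: "x (2 * k) \<le> x (2 * k + 2)" if "k < m" for k
    using pairs[OF that] odd[of k] that by simp
  have "(\<Sum>n\<le>2 * m + 1. x n) = 1"
    unfolding x_def by (rule sum_pmf_eq_1) (use x_beyond x_def in auto)
  moreover have "(\<Sum>n\<le>2 * m. x n) = (x 0 + x (2 * m)) / 2 + real m * (1 / b)"
    by (rule sum_atMost_even[where m = m]) (use pairs in auto)
  ultimately have last: "x (2 * m + 1) = 1 - real m / b - (x 0 + x (2 * m)) / 2"
    by simp
  txt \<open>The even bids have nondecreasing probabilities, and \<open>V m j\<close> is the only ingredient
    with a jump between the bids \<open>2 * j - 2\<close> and \<open>2 * j\<close>.\<close>
  define c where "c j = (2 * real m + 1) / 2 * (x (2 * j) - x (2 * j - 2))" for j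
  have sum_c: "(\<Sum>j=1..k. c j) = (2 * real m + 1) / 2 * (x (2 * k) - x 0)" for k
  proof (induction k)
    case (Suc k)
    have "c (Suc k) = (2 * real m + 1) / 2 * (x (2 * Suc k) - x (2 * k))"
      by (simp add: c_def)
    then show ?case
      using Suc by (simp add: right_diff_distrib)
  qed simp
  \<comment> \<open>\<open>q\<close> and \<open>r\<close> are forced by the bids
    \<open>2 * m + 1\<close> and 0; \<open>p\<close> takes the remaining mass.\<close>
  define q r p where "q = (real m + 1) * x (2 * m + 1)" and "r = (real m + 1) * x 0"
    and "p = 1 - q - r - (\<Sum>j=1..m. c j)"
  \<comment> \<open>In this form the sign of \<open>p\<close> is player 2's optimality condition at
    the bid \<open>2 * m + 1\<close>.\<close>
  have p_eq: "p = real m * (1 / b - (x (2 * m) + x (2 * m + 1)))"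
  proof -
    have m_b: "real m * (1 / b) = 1 - x (2 * m + 1) - (x 0 + x (2 * m)) / 2"
      using last by simp
    show ?thesis
      unfolding p_def q_def r_def sum_c right_diff_distrib m_b by (simp add: field_simps)
  qed
  have adm: "admissible p q r c"
    unfolding admissible_def
  proof (intro conjI ballI)
    show "0 \<le> p"
      unfolding p_eq using odd[of m] by simp
    show "0 \<le> q" "0 \<le> r"
      by (simp_all add: q_def r_def x_nonneg)
    show "0 \<le> c j" if "j \<in> {1..m}" for j
      using mono[of "j - 1"] that by (cases j) (simp_all add: c_def)
    show "p + q + r + (\<Sum>j=1..m. c j) = 1"
      by (simp add: p_def)
    have "(q + r) / real (m + 1) = x (2 * m + 1) + x 0"
      by (simp add: q_def r_def field_simps)
    moreover have "2 * (\<Sum>j=1..m. c j) / real (2 * m + 1) = x (2 * m) - x 0"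
      unfolding sum_c by (simp add: field_simps)
    moreover have "p / real m = 1 / b - (x (2 * m) + x (2 * m + 1))"
      unfolding p_eq using m_pos by simp
    ultimately show "p / real m + (q + r) / real (m + 1) + 2 * (\<Sum>j=1..m. c j) / real (2 * m + 1) = 1 / b"
      by linarith
  qed
  have evens: "mixture m p q r c (2 * k) = x (2 * k)" if "k \<le> m" for k
  proof -
    have "r / real (m + 1) = x 0" "2 / real (2 * m + 1) * ((2 * real m + 1) / 2 * y) = y" for y
      by (simp_all add: r_def field_simps)
    then show ?thesis
      unfolding mixture_even[OF that] sum_c by simp
  qed
  have "x n = mixture m p q r c n" for n
  proof (cases rule: bid_cases[of n m])
    case (1 k)
    then show ?thesis
      by (simp add: evens)
  next
    case (2 k)
    \<comment> \<open>At an odd bid both sides are determined by the two even neighbours through the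
      same pair equation.\<close>
    have "mixture m p q r c (2 * k + 2) = x (2 * k + 2)"
      using evens[of "k + 1"] 2 by simp
    then show ?thesis
      using admissible_mixture_pairs[OF adm 2(2)] pairs[OF 2(2)] evens[of k] 2 by simp
  next
    case 3
    have "q / real (m + 1) = x (2 * m + 1)"
      by (simp add: q_def field_simps)
    then show ?thesis
      unfolding 3 mixture_last by simp
  next
    case 4
    then show ?thesis
      by (simp add: x_beyond mixture_beyond)
  qed
  moreover have "a > real m + 1 \<longrightarrow> r = 0"
    using x_0 by (simp add: r_def)
  ultimately show ?thesis
    using adm unfolding x_def by blast
qed

text \<open>Player 2 stays on even bids, and \<open>X\<close> charges every bid from 1 to
  \<open>2 * m + 1\<close>, so player 1 is indifferent there. Consecutive differences then fix
  \<open>Y\<close> at positive bids, and certain victory at \<open>2 * m + 1\<close> fixes the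
  payoff and with it the mass at 0.\<close>

lemma nash_eq_positive_mixture_unique:
  assumes a: "a \<ge> real m + 1"
    and adm: "admissible p q r c" and X: "\<And>n. pmf X n = mixture m p q r c n"
    and pos: "p > 0" "q > 0" "\<And>j. j \<in> {1..m} \<Longrightarrow> c j > 0"
    and nash: "nash_eq (2 * a) (2 * b) X Y"
  shows "pmf Y n = weak_strategy m a n"
proof -
  have a_pos: "a > 0"
    using a by linarith
  have w2: "payoff (2 * b) Y X = b * r / real (m + 1)"
    using payoff_against_mixture_le[OF adm X] payoff_against_mixture_even[OF adm X, of 0]
    by (intro nash_eq_payoff_unique[OF nash_eq_swap[THEN iffD1, OF nash], of _ 0]) auto
  have y_zero: "pmf Y n = 0" if "\<not> (even n \<and> n \<le> 2 * m)" for n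
    using nash_eqD(4)[OF nash, of n] payoff_against_positive_mixture_eq[OF adm X pos(1,3), of n] that
    unfolding w2 by (auto simp: set_pmf_iff)
  have nonneg: "0 \<le> p" "0 \<le> q" "0 \<le> r" "\<And>j. j \<in> {1..m} \<Longrightarrow> 0 \<le> c j"
    using adm by (auto simp: admissible_def)
  have supp: "n \<in> set_pmf X" if "1 \<le> n" "n \<le> 2 * m + 1" for n
  proof -
    have "0 < mixture m p q r c n"
    proof (cases rule: bid_cases[of n m])
      case (1 k)
      then have "0 < (\<Sum>j=1..k. c j)"
        using pos(3) that by (intro sum_pos) auto
      then show ?thesis
        using mixture_even[OF 1(2)] 1(1) nonneg(3) by (simp add: add_nonneg_pos)
    next
      case (2 k)
      have "0 < p * UO m n" "0 \<le> q * UO (m + 1) n" "0 \<le> r * UE m n" "0 \<le> (\<Sum>j=1..m. c j * V m j n)"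
        using pos 2 nonneg UO_odd[of m k] by (auto intro!: sum_nonneg simp: V_def UO_def UE_def)
      then show ?thesis
        by (simp add: mixture_def)
    next
      case 3
      then show ?thesis
        using pos mixture_last[of m p q r c] by simp
    qed (use that in auto)
    then show ?thesis
      by (simp add: set_pmf_iff X)
  qed
  define w1 where "w1 = payoff (2 * a) X Y"
  have win: "2 * a * win Y n = w1 + real n" if "1 \<le> n" "n \<le> 2 * m + 1" for n
    using nash_eqD(2)[OF nash supp[OF that]] by (simp add: w1_def)
  have "a * (pmf Y n + pmf Y (Suc n)) = 1" if "1 \<le> n" "n \<le> 2 * m" for n
    using win[of n] win[of "Suc n"] win_Suc[of Y n] that by (simp add: algebra_simps)
  then have step: "pmf Y n + pmf Y (Suc n) = 1 / a" if "1 \<le> n" "n \<le> 2 * m" for n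
    using that a_pos by (simp add: field_simps)
  have "win Y (2 * m + 1) = 1"
    using y_zero by (intro win_beyond[where N = "2 * m"]) auto
  then have "w1 = 2 * a - 2 * real m - 1"
    using win[of "2 * m + 1"] by simp
  moreover have "win Y 1 = pmf Y 0"
    using y_zero[of 1] by (simp add: win_Suc[of Y 0, simplified] win_0)
  ultimately have "2 * a * pmf Y 0 = 2 * a - 2 * real m"
    using win[of 1] by simp
  then have y0: "pmf Y 0 = 1 - real m / a"
    using a_pos by (simp add: field_simps)
  show ?thesis
  proof (cases "n \<noteq> 0 \<and> even n \<and> n \<le> 2 * m")
    case True
    then show ?thesis
      using step[of n] y_zero[of "Suc n"] by (simp add: weak_strategy_def)
  next
    case False
    then show ?thesis
      using y0 y_zero[of n] by (auto simp: weak_strategy_def)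
  qed
qed

text \<open>With \<open>r = 0\<close> the two equations leave the total \<open>C\<close> of the
  weights \<open>c\<close> free. As \<open>0 < \<beta> < 1\<close>, any positive \<open>C\<close>
  below both \<open>\<beta>\<close> and \<open>1 - \<beta>\<close> leaves \<open>p\<close> and
  \<open>q\<close> positive; it is spread evenly over the \<open>V m j\<close>.\<close>

lemma ex_positive_admissible:
  obtains p q c where "admissible p q 0 c" "p > 0" "q > 0" "\<And>j. j \<in> {1..m} \<Longrightarrow> c j > 0"
proof -
  define \<beta> where "\<beta> = real (m + 1) / b * (b - real m)"
  have \<beta>: "0 < \<beta>" "\<beta> < 1"
  proof -
    show "0 < \<beta>"
      using b_pos b_gt by (simp add: \<beta>_def)
    have "real m * b < real m * (real m + 1)"
      using b_less m_pos by simp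
    then show "\<beta> < 1"
      using b_pos by (simp add: \<beta>_def field_simps)
  qed
  define C where "C = min \<beta> (1 - \<beta>) / 2"
  define t where "t = real (m + 1) / real (2 * m + 1)"
  have t: "0 < t" "t < 1"
    using m_pos by (simp_all add: t_def)
  have C: "0 < C" "C < \<beta>" "C < 1 - \<beta>"
    using \<beta> by (auto simp: C_def min_def)
  have tC: "0 < t * C" "t * C < C"
    using t C by simp_all
  let ?q = "\<beta> - t * C" and ?p = "1 - (\<beta> - t * C) - C" and ?c = "\<lambda>j. C / real m"
  have "?p + ?q + 0 + C = 1" "?q + 0 + C * real (m + 1) / real (2 * m + 1) = real (m + 1) / b * (b - real m)"
    by (simp_all add: t_def \<beta>_def)
  moreover have sum: "(\<Sum>j=1..m. ?c j) = C"
    using m_pos by simp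
  ultimately have "admissible ?p ?q 0 ?c"
    using C tC admissible_fraction[of ?p ?q 0 C] unfolding admissible_def sum by auto
  then show ?thesis
    by (rule that) (use C tC m_pos in auto)
qed

theorem nash_eq_iff_weak:
  assumes a: "a \<ge> real m + 1" and X: "strategy X" and Y: "strategy Y"
  shows "nash_eq (2 * a) (2 * b) X Y \<longleftrightarrow>
    (\<forall>n. pmf Y n = weak_strategy m a n) \<and>
    (\<exists>p q r c. admissible p q r c \<and> (a > real m + 1 \<longrightarrow> r = 0) \<and>
      (\<forall>n. pmf X n = mixture m p q r c n))"
proof
  assume nash: "nash_eq (2 * a) (2 * b) X Y"
  have a_pos: "a > 0" "a \<ge> real m"
    using a by linarith+
  obtain p q c where adm: "admissible p q 0 c" and pos: "p > 0" "q > 0" "\<And>j. j \<in> {1..m} \<Longrightarrow> c j > 0"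
    using ex_positive_admissible by blast
  then obtain X' where X': "strategy X'" "\<And>n. pmf X' n = mixture m p q 0 c n"
    using ex_pmf_mixture[of m p q 0 c] m_pos by (auto simp: admissible_def)
  obtain Y' where Y': "strategy Y'" "\<And>n. pmf Y' n = weak_strategy m a n"
    using ex_pmf_weak_strategy[OF a_pos] by blast
  \<comment> \<open>The zero weight of \<open>UE m\<close> makes the same kind of \<open>X'\<close>
    an equilibrium strategy at the boundary and above it.\<close>
  have nash': "nash_eq (2 * a) (2 * b) X' Y'"
    using nash_eq_mixture_weak[OF a Y'(2) X'(1) Y'(1) adm X'(2)] by simp
  have "nash_eq (2 * a) (2 * b) X' Y"
    using nash_eq_interchange[OF _ _ nash' nash] a_pos b_pos by simp
  then have weak: "pmf Y n = weak_strategy m a n" for n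
    using nash_eq_positive_mixture_unique[OF a adm X'(2) pos] by blast
  with nash_eq_weak_imp_mixture[OF a weak nash]
  show "(\<forall>n. pmf Y n = weak_strategy m a n) \<and>
    (\<exists>p q r c. admissible p q r c \<and> (a > real m + 1 \<longrightarrow> r = 0) \<and>
      (\<forall>n. pmf X n = mixture m p q r c n))"
    by blast
next
  assume "(\<forall>n. pmf Y n = weak_strategy m a n) \<and>
    (\<exists>p q r c. admissible p q r c \<and> (a > real m + 1 \<longrightarrow> r = 0) \<and>
      (\<forall>n. pmf X n = mixture m p q r c n))"
  then show "nash_eq (2 * a) (2 * b) X Y"
    using nash_eq_mixture_weak[OF a _ X Y] by blast
qed

lemma nash_eq_weak_payoffs:
  assumes a: "a \<ge> real m + 1" and nash: "nash_eq (2 * a) (2 * b) X Y"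
    and Y: "\<And>n. pmf Y n = weak_strategy m a n"
  shows "payoff (2 * a) X Y = 2 * a - 2 * real m - 1" "payoff (2 * b) Y X = b * pmf X 0"
proof -
  have a_pos: "a > 0" "a > real m"
    using a by linarith+
  show "payoff (2 * a) X Y = 2 * a - 2 * real m - 1"
    using payoff_against_weak_le[OF a Y] payoff_against_weak_inner[OF a_pos(1) Y, of 1]
    by (intro nash_eq_payoff_unique[OF nash, of _ 1]) auto
  have "0 \<in> set_pmf Y"
    using a_pos by (simp add: set_pmf_iff Y weak_strategy_def)
  then show "payoff (2 * b) Y X = b * pmf X 0"
    using nash_eqD(4)[OF nash, of 0] by (simp add: win_0)
qed

end

subsection \<open>Half-valuations with equal integer parts\<close>

text \<open>The two alternating values add up to \<open>1 / c\<close>, which makes a player of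
  valuation \<open>2 * c\<close> indifferent; each player's strategy is therefore balanced for the
  opponent's valuation.\<close>

definition balanced :: "nat \<Rightarrow> real \<Rightarrow> nat \<Rightarrow> real" where
  "balanced m c n =
     (if n \<le> 2 * m then if even n then 1 - real m / c else (real m + 1 - c) / c else 0)"

context auction
begin

lemma balanced_step:
  assumes "n < 2 * m"
  shows "balanced m b n + balanced m b (Suc n) = 1 / b"
  using assms b_pos by (cases "even n") (auto simp: balanced_def field_simps)

lemma balanced_pos:
  assumes "n \<le> 2 * m"
  shows "0 < balanced m b n"
  using assms b_pos b_gt b_less by (auto simp: balanced_def field_simps)

lemma balanced_nonneg: "0 \<le> balanced m b n"
  by (metis balanced_def balanced_pos less_eq_real_def)

lemma ex_pmf_balanced: "\<exists>Z. strategy Z \<and> (\<forall>n. pmf Z n = balanced m b n)"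
proof (rule ex_pmf_finite_support[where N = "2 * m"])
  have "(\<Sum>n\<le>2 * m. balanced m b n) = (balanced m b 0 + balanced m b (2 * m)) / 2 + real m * (1 / b)"
  proof (rule sum_atMost_even[where m = m])
    show "balanced m b (2 * k) + 2 * balanced m b (2 * k + 1) + balanced m b (2 * k + 2) = 2 * (1 / b)"
      if "k < m" for k
      using balanced_step[of "2 * k"] balanced_step[of "2 * k + 1"] that by simp
  qed simp
  moreover have "balanced m b 0 = 1 - real m * (1 / b)" "balanced m b (2 * m) = 1 - real m * (1 / b)"
    by (simp_all add: balanced_def)
  ultimately show "(\<Sum>n\<le>2 * m. balanced m b n) = 1"
    using b_pos by (simp add: field_simps)
qed (auto simp: balanced_nonneg, simp add: balanced_def)

context
  fixes Z
  assumes Z: "\<And>n. pmf Z n = balanced m b n"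
begin

lemma payoff_against_balanced_inner:
  assumes "n \<le> 2 * m"
  shows "2 * b * win Z n - real n = b - real m"
  using assms
proof (induction n)
  case 0
  then show ?case
    using b_pos by (simp add: win_0 Z balanced_def field_simps)
next
  case (Suc n)
  have "win Z (Suc n) = win Z n + (1 / b) / 2"
    using balanced_step[of n] Suc.prems unfolding win_Suc Z by simp
  then have "2 * b * win Z (Suc n) = 2 * b * win Z n + 1"
    using b_pos by (simp add: field_simps)
  then show ?case
    using Suc by simp
qed

text \<open>Winning is certain, but the payoff is at most \<open>2 * b - 2 * m - 1\<close>, which is
  below \<open>b - m\<close> because \<open>b < m + 1\<close>.\<close>

lemma payoff_against_balanced_outer:
  assumes "n > 2 * m"
  shows "2 * b * win Z n - real n < b - real m"
proof -
  have "win Z n = 1"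
    using assms by (intro win_beyond[where N = "2 * m"]) (auto simp: Z balanced_def)
  then show ?thesis
    using assms b_less by simp
qed

lemma payoff_against_balanced_le: "2 * b * win Z n - real n \<le> b - real m"
  using payoff_against_balanced_inner[of n] payoff_against_balanced_outer[of n] by force

end

text \<open>Indifference fixes the sum of consecutive probabilities, so all even bids have the same
  probability; the total mass then determines it.\<close>

lemma balanced_unique:
  assumes indiff: "\<And>n. n \<le> 2 * m \<Longrightarrow> 2 * b * win Z n - real n = w"
    and beyond: "\<And>n. n > 2 * m \<Longrightarrow> pmf Z n = 0"
  shows "pmf Z n = balanced m b n"
proof -
  have "b * (pmf Z n + pmf Z (Suc n)) = 1" if "n < 2 * m" for n
    using indiff[of n] indiff[of "Suc n"] win_Suc[of Z n] that by (simp add: algebra_simps)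
  then have step: "pmf Z n + pmf Z (Suc n) = 1 / b" if "n < 2 * m" for n
    using that b_pos by (simp add: field_simps)
  have even: "pmf Z (2 * k) = pmf Z 0" if "k \<le> m" for k
    using that
  proof (induction k)
    case (Suc k)
    then show ?case
      using step[of "2 * k"] step[of "2 * k + 1"] by simp
  qed simp
  have "(\<Sum>n\<le>2 * m. pmf Z n) = 1"
    by (rule sum_pmf_eq_1) (use beyond in auto)
  moreover have "(\<Sum>n\<le>2 * m. pmf Z n) = (pmf Z 0 + pmf Z (2 * m)) / 2 + real m * (1 / b)"
  proof (rule sum_atMost_even[where m = m])
    show "pmf Z (2 * k) + 2 * pmf Z (2 * k + 1) + pmf Z (2 * k + 2) = 2 * (1 / b)" if "k < m" for k
      using step[of "2 * k"] step[of "2 * k + 1"] that by simp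
  qed simp
  ultimately have z0: "pmf Z 0 = 1 - real m / b"
    using even[of m] by simp
  show ?thesis
  proof (cases rule: bid_cases[of n m])
    case (1 k)
    then show ?thesis
      using even[of k] z0 by (simp add: balanced_def)
  next
    case (2 k)
    then have "pmf Z n = 1 / b - (1 - real m / b)"
      using even[of k] z0 step[of "2 * k"] by simp
    then show ?thesis
      using 2 b_pos by (simp add: balanced_def field_simps)
  qed (simp_all add: beyond balanced_def)
qed

text \<open>The weight is the \<lambda> or \<kappa> of case (i): it satisfies
  \<open>1 - w = (1 - m / b) * (m + 1)\<close>, so that each even bid receives
  \<open>1 - m / b\<close>.\<close>

lemma UO_UE_eq_balanced:
  defines "w \<equiv> real m / b * (real m + 1 - b)"
  shows "w * UO m n + (1 - w) * UE m n = balanced m b n"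
proof (cases rule: bid_cases[of n m])
  case (1 k)
  have "1 - w = (1 - real m / b) * (real m + 1)"
    using b_pos by (simp add: w_def field_simps)
  then have "(1 - w) / (real m + 1) = 1 - real m / b"
    by simp
  then show ?thesis
    using 1 UO_even[of m k] UE_even[of m k] by (simp add: balanced_def add.commute)
next
  case (2 k)
  have "w / real m = (real m + 1 - b) / b"
    using b_pos m_pos by (simp add: w_def)
  then show ?thesis
    using 2 UO_odd[of m k] UE_odd[of m k] by (simp add: balanced_def)
qed (auto simp: UO_def UE_def balanced_def)

end

section \<open>The unique equilibrium for equal integer parts\<close>

locale balanced_auction = auction +
  fixes a :: real
  assumes a_gt: "real m < a" and a_less: "a < real m + 1"
begin

sublocale a: auction m a
  by unfold_locales (use m_pos a_gt a_less in auto)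

lemma nash_eq_balanced:
  assumes "strategy X" "\<And>n. pmf X n = balanced m b n"
    and "strategy Y" "\<And>n. pmf Y n = balanced m a n"
  shows "nash_eq (2 * a) (2 * b) X Y"
proof (rule nash_eqI)
  have supp: "n \<le> 2 * m" if "n \<in> set_pmf X \<or> n \<in> set_pmf Y" for n
    using that assms by (auto simp: set_pmf_iff balanced_def split: if_splits)
  show "2 * a * win Y n - real n \<le> a - real m" for n
    by (rule a.payoff_against_balanced_le[OF assms(4)])
  show "2 * b * win X n - real n \<le> b - real m" for n
    by (rule payoff_against_balanced_le[OF assms(2)])
  show "2 * a * win Y n - real n = a - real m" if "n \<in> set_pmf X" for n
    using a.payoff_against_balanced_inner[OF assms(4)] supp that by blast
  show "2 * b * win X n - real n = b - real m" if "n \<in> set_pmf Y" for n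
    using payoff_against_balanced_inner[OF assms(2)] supp that by blast
qed (use assms in auto)

text \<open>Full support of \<open>Y\<close> on \<open>{0..2 * m}\<close> forces indifference of
  player 2 on this set, while bids above \<open>2 * m\<close> are strictly worse for player 1 and
  cannot be used by \<open>X\<close>.\<close>

lemma nash_eq_balanced_unique:
  assumes "nash_eq (2 * a) (2 * b) X Y" "\<And>n. pmf Y n = balanced m a n"
  shows "pmf X n = balanced m b n"
proof (rule balanced_unique)
  have w1: "payoff (2 * a) X Y = a - real m"
    using a.payoff_against_balanced_le[OF assms(2)] a.payoff_against_balanced_inner[OF assms(2), of 0]
    by (intro nash_eq_payoff_unique[OF assms(1), of _ 0]) auto
  show "2 * b * win X n - real n = payoff (2 * b) Y X" if "n \<le> 2 * m" for n
    using nash_eqD(4)[OF assms(1), of n] a.balanced_pos[OF that] by (simp add: set_pmf_iff assms(2))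
  show "pmf X n = 0" if "n > 2 * m" for n
    using nash_eqD(2)[OF assms(1), of n] a.payoff_against_balanced_outer[OF assms(2) that] w1
    by (auto simp: set_pmf_iff)
qed

text \<open>The assumptions are symmetric in \<open>a\<close> and \<open>b\<close>, so uniqueness of
  \<open>X\<close> also yields uniqueness of \<open>Y\<close>.\<close>

interpretation swapped: balanced_auction m a b
  by unfold_locales (use m_pos a_gt a_less b_gt b_less in auto)

theorem nash_eq_iff_balanced:
  assumes "strategy X" "strategy Y"
  shows "nash_eq (2 * a) (2 * b) X Y \<longleftrightarrow>
    (\<forall>n. pmf X n = balanced m b n) \<and> (\<forall>n. pmf Y n = balanced m a n)"
proof
  assume nash: "nash_eq (2 * a) (2 * b) X Y"
  obtain X' where X': "strategy X'" "\<And>n. pmf X' n = balanced m b n"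
    using ex_pmf_balanced by blast
  obtain Y' where Y': "strategy Y'" "\<And>n. pmf Y' n = balanced m a n"
    using a.ex_pmf_balanced by blast
  have nash': "nash_eq (2 * a) (2 * b) X' Y'"
    by (rule nash_eq_balanced[OF X' Y'])
  have "nash_eq (2 * a) (2 * b) X Y'" "nash_eq (2 * a) (2 * b) X' Y"
    using nash_eq_interchange[OF _ _ nash nash'] nash_eq_interchange[OF _ _ nash' nash]
      a.b_pos b_pos by simp_all
  then show "(\<forall>n. pmf X n = balanced m b n) \<and> (\<forall>n. pmf Y n = balanced m a n)"
    using nash_eq_balanced_unique[OF _ Y'(2)] swapped.nash_eq_balanced_unique[OF _ X'(2)]
      nash_eq_swap by blast
qed (use nash_eq_balanced assms in blast)

lemma nash_eq_balanced_payoffs: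
  assumes "nash_eq (2 * a) (2 * b) X Y"
  shows "payoff (2 * a) X Y = a - real m" "payoff (2 * b) Y X = b - real m"
proof -
  have XY: "\<And>n. pmf X n = balanced m b n" "\<And>n. pmf Y n = balanced m a n"
    using nash_eq_iff_balanced[of X Y] assms by (auto simp: nash_eq_def)
  show "payoff (2 * a) X Y = a - real m"
    using a.payoff_against_balanced_le[OF XY(2)] a.payoff_against_balanced_inner[OF XY(2), of 0]
    by (intro nash_eq_payoff_unique[OF assms, of _ 0]) auto
  show "payoff (2 * b) Y X = b - real m"
    using payoff_against_balanced_le[OF XY(1)] payoff_against_balanced_inner[OF XY(1), of 0]
    by (intro nash_eq_payoff_unique[OF nash_eq_swap[THEN iffD1, OF assms], of _ 0]) auto
qed

end

subsection \<open>The convex combinations of the theorem\<close>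

lemma sum_affine:
  fixes l f :: "'a \<Rightarrow> real"
  shows "(\<Sum>j\<in>A. l j * (s * f j + t * u)) = (\<Sum>j\<in>A. l j * s * f j) + (\<Sum>j\<in>A. l j) * t * u"
  by (simp add: distrib_left sum.distrib sum_distrib_right mult.assoc)

context auction
begin

definition \<delta> :: real where "\<delta> = real (2 * m + 1) / real (m + 1)"
definition \<sigma> :: real where "\<sigma> = real (2 * m + 1) / real m"
definition \<alpha>_max :: real where "\<alpha>_max = (real m + 1) / b * (b - real m)"

lemma \<delta>_gt_1: "1 < \<delta>"
  using m_pos by (simp add: \<delta>_def)

lemma \<sigma>_pos: "0 < \<sigma>"
  using m_pos by (simp add: \<sigma>_def)

text \<open>Hence \<open>\<alpha> * \<delta> \<le> 1\<close> holds exactly for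
  \<open>\<alpha> \<le> 1 / \<delta>\<close>, and \<open>(1 - \<alpha>) * \<sigma> \<le> 1\<close>
  exactly for \<open>\<alpha> \<ge> 1 / \<delta>\<close>: this is the threshold between (a) and
  (b).\<close>

lemma inverse_\<delta>_\<sigma>: "1 / \<delta> + 1 / \<sigma> = 1"
  using m_pos by (simp add: \<delta>_def \<sigma>_def add_divide_distrib[symmetric])

lemma \<alpha>_max_pos: "0 < \<alpha>_max"
  using b_pos b_gt by (simp add: \<alpha>_max_def)

lemma \<alpha>_max_less_1: "\<alpha>_max < 1"
proof -
  have "real m * b < real m * (real m + 1)"
    using b_less m_pos by simp
  then show ?thesis
    using b_pos by (simp add: \<alpha>_max_def field_simps)
qed

text \<open>Identifies the case split on \<open>v2 / 2\<close> in (iii) with the threshold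
  \<open>1 / \<delta>\<close> of case (ii).\<close>

lemma \<alpha>_max_le_iff: "\<alpha>_max \<le> 1 / \<delta> \<longleftrightarrow> b \<le> real m + 1 / 2"
proof -
  have "\<alpha>_max = (real m + 1) * ((b - real m) / b)" "1 / \<delta> = (real m + 1) * (1 / (2 * real m + 1))"
    by (simp_all add: \<alpha>_max_def \<delta>_def add.commute)
  then have "\<alpha>_max \<le> 1 / \<delta> \<longleftrightarrow> (b - real m) / b \<le> 1 / (2 * real m + 1)"
    by (simp only: mult_le_cancel_left) auto
  also have "\<dots> \<longleftrightarrow> (b - real m) * (2 * real m + 1) \<le> b"
    using b_pos by (simp add: divide_simps)
  also have "\<dots> \<longleftrightarrow> 2 * real m * b \<le> 2 * real m * (real m + 1 / 2)"
    by (auto simp: algebra_simps)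
  also have "\<dots> \<longleftrightarrow> b \<le> real m + 1 / 2"
    using m_pos by (subst mult_le_cancel_left_pos) auto
  finally show ?thesis .
qed

lemma admissible_iff:
  "admissible p q r c \<longleftrightarrow>
     0 \<le> p \<and> 0 \<le> q \<and> 0 \<le> r \<and> (\<forall>j\<in>{1..m}. 0 \<le> c j) \<and>
     p + q + r + (\<Sum>j=1..m. c j) = 1 \<and> q + r + (\<Sum>j=1..m. c j) / \<delta> = \<alpha>_max"
proof -
  have "C / \<delta> = C * real (m + 1) / real (2 * m + 1)" for C
    by (simp add: \<delta>_def)
  moreover have "\<alpha>_max = real (m + 1) / b * (b - real m)"
    by (simp add: \<alpha>_max_def add.commute)
  ultimately show ?thesis
    unfolding admissible_def using admissible_fraction by metis
qed

text \<open>The predicates \<open>coeffs_low\<close> and \<open>coeffs_high\<close> are the parametrisations (a) and (b) of case (ii);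
  case (iii) is their slice \<open>\<alpha> = \<alpha>_max\<close>. In terms of \<open>admissible\<close>, \<open>\<alpha>\<close> is \<open>\<alpha>_max - r\<close>.\<close>

definition coeffs_low :: "real \<Rightarrow> real \<Rightarrow> real \<Rightarrow> (nat \<Rightarrow> real) \<Rightarrow> (nat \<Rightarrow> real) \<Rightarrow> bool" where
  "coeffs_low \<alpha> lO lE l k \<longleftrightarrow>
     0 \<le> \<alpha> \<and> \<alpha> \<le> 1 / \<delta> \<and> 0 \<le> lO \<and> 0 \<le> lE \<and> (\<forall>j\<in>{1..m}. 0 \<le> l j \<and> 0 \<le> k j) \<and>
     lO + lE + (\<Sum>j=1..m. l j) + (\<Sum>j=1..m. k j) = 1 \<and>
     lE + (\<Sum>j=1..m. k j * (1 - \<alpha> * \<delta>) / (1 - \<alpha>)) = \<alpha>_max / (1 - \<alpha>) - \<alpha> / (1 - \<alpha>)"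

definition mixture_low where
  "mixture_low \<alpha> lO lE l k n =
       lO * ((1 - \<alpha>) * UO m n + \<alpha> * UO (m + 1) n)
     + lE * ((1 - \<alpha>) * UE m n + \<alpha> * UO (m + 1) n)
     + (\<Sum>j=1..m. l j * (\<alpha> * \<delta> * V m j n + (1 - \<alpha> * \<delta>) * UO m n))
     + (\<Sum>j=1..m. k j * (\<alpha> * \<delta> * V m j n + (1 - \<alpha> * \<delta>) * UE m n))"

definition coeffs_high :: "real \<Rightarrow> real \<Rightarrow> real \<Rightarrow> (nat \<Rightarrow> real) \<Rightarrow> bool" where
  "coeffs_high \<alpha> lO lE l \<longleftrightarrow>
     1 / \<delta> < \<alpha> \<and> \<alpha> \<le> \<alpha>_max \<and> 0 \<le> lO \<and> 0 \<le> lE \<and> (\<forall>j\<in>{1..m}. 0 \<le> l j) \<and>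
     lO + lE + (\<Sum>j=1..m. l j) = 1 \<and> lE = \<alpha>_max / (1 - \<alpha>) - \<alpha> / (1 - \<alpha>)"

definition mixture_high where
  "mixture_high \<alpha> lO lE l n =
       lO * ((1 - \<alpha>) * UO m n + \<alpha> * UO (m + 1) n)
     + lE * ((1 - \<alpha>) * UE m n + \<alpha> * UO (m + 1) n)
     + (\<Sum>j=1..m. l j * ((1 - \<alpha>) * \<sigma> * V m j n + (1 - (1 - \<alpha>) * \<sigma>) * UO (m + 1) n))"

lemma mixture_low_eq:
  "mixture_low \<alpha> lO lE l k = mixture m
     (lO * (1 - \<alpha>) + (\<Sum>j=1..m. l j) * (1 - \<alpha> * \<delta>))
     ((lO + lE) * \<alpha>)
     (lE * (1 - \<alpha>) + (\<Sum>j=1..m. k j) * (1 - \<alpha> * \<delta>))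
     (\<lambda>j. (l j + k j) * (\<alpha> * \<delta>))"
  unfolding mixture_low_def mixture_def sum_affine
  by (simp add: fun_eq_iff distrib_left distrib_right sum.distrib)

lemma mixture_high_eq:
  "mixture_high \<alpha> lO lE l = mixture m
     (lO * (1 - \<alpha>))
     ((lO + lE) * \<alpha> + (\<Sum>j=1..m. l j) * (1 - (1 - \<alpha>) * \<sigma>))
     (lE * (1 - \<alpha>))
     (\<lambda>j. l j * ((1 - \<alpha>) * \<sigma>))"
  unfolding mixture_high_def mixture_def sum_affine
  by (simp add: fun_eq_iff distrib_left distrib_right)

lemma inverse_\<delta>_less_1: "1 / \<delta> < 1"
  using \<delta>_gt_1 by simp

lemma coeffs_low_admissible:
  assumes "coeffs_low \<alpha> lO lE l k"
  shows "\<exists>p q c. admissible p q (\<alpha>_max - \<alpha>) c \<and> mixture_low \<alpha> lO lE l k = mixture m p q (\<alpha>_max - \<alpha>) c"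
proof -
  define L K where "L = (\<Sum>j=1..m. l j)" and "K = (\<Sum>j=1..m. k j)"
  have \<alpha>: "0 \<le> \<alpha>" "\<alpha> \<le> 1 / \<delta>" and nonneg: "0 \<le> lO" "0 \<le> lE" "\<forall>j\<in>{1..m}. 0 \<le> l j \<and> 0 \<le> k j"
    and total: "lO + lE + L + K = 1"
    and weight: "lE + (\<Sum>j=1..m. k j * (1 - \<alpha> * \<delta>) / (1 - \<alpha>)) = \<alpha>_max / (1 - \<alpha>) - \<alpha> / (1 - \<alpha>)"
    using assms by (simp_all add: coeffs_low_def L_def K_def)
  have "\<alpha> < 1"
    using \<alpha> inverse_\<delta>_less_1 by linarith
  have \<alpha>\<delta>: "0 \<le> 1 - \<alpha> * \<delta>"
    using \<alpha>(2) \<delta>_gt_1 by (simp add: field_simps)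
  have "(\<Sum>j=1..m. k j * (1 - \<alpha> * \<delta>) / (1 - \<alpha>)) = K * (1 - \<alpha> * \<delta>) / (1 - \<alpha>)"
    by (simp add: K_def sum_distrib_right sum_divide_distrib)
  then have "lE + K * (1 - \<alpha> * \<delta>) / (1 - \<alpha>) = (\<alpha>_max - \<alpha>) / (1 - \<alpha>)"
    using weight by (simp add: diff_divide_distrib)
  then have "(lE + K * (1 - \<alpha> * \<delta>) / (1 - \<alpha>)) * (1 - \<alpha>) = \<alpha>_max - \<alpha>"
    using \<open>\<alpha> < 1\<close> by simp
  \<comment> \<open>Cleared of \<open>1 - \<alpha>\<close>, the weight equation says that the total
    weight of \<open>UE m\<close> is \<open>\<alpha>_max - \<alpha>\<close>.\<close>
  then have r: "lE * (1 - \<alpha>) + K * (1 - \<alpha> * \<delta>) = \<alpha>_max - \<alpha>"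
    using \<open>\<alpha> < 1\<close> by (simp add: distrib_right)
  have LK: "0 \<le> L" "0 \<le> K"
    using nonneg by (auto simp: L_def K_def intro!: sum_nonneg)
  have C: "(\<Sum>j=1..m. (l j + k j) * (\<alpha> * \<delta>)) = (L + K) * (\<alpha> * \<delta>)"
    by (simp only: L_def K_def sum.distrib[symmetric] sum_distrib_right)
  have "admissible (lO * (1 - \<alpha>) + L * (1 - \<alpha> * \<delta>)) ((lO + lE) * \<alpha>) (\<alpha>_max - \<alpha>)
      (\<lambda>j. (l j + k j) * (\<alpha> * \<delta>))"
    unfolding admissible_iff C
  proof (intro conjI ballI)
    show "lO * (1 - \<alpha>) + L * (1 - \<alpha> * \<delta>) + (lO + lE) * \<alpha> + (\<alpha>_max - \<alpha>) + (L + K) * (\<alpha> * \<delta>) = 1"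
      using total by (simp add: r[symmetric] algebra_simps)
    have "(L + K) * (\<alpha> * \<delta>) / \<delta> = (L + K) * \<alpha>"
      using \<delta>_gt_1 by simp
    moreover have "(lO + lE) * \<alpha> + (L + K) * \<alpha> = \<alpha>"
      using total by (metis add.assoc distrib_right mult_1)
    ultimately show "(lO + lE) * \<alpha> + (\<alpha>_max - \<alpha>) + (L + K) * (\<alpha> * \<delta>) / \<delta> = \<alpha>_max"
      by linarith
    show "0 \<le> \<alpha>_max - \<alpha>"
      using nonneg LK \<alpha>\<delta> \<open>\<alpha> < 1\<close> by (simp add: r[symmetric])
  qed (use nonneg LK \<alpha> \<alpha>\<delta> \<open>\<alpha> < 1\<close> \<delta>_gt_1 in auto)
  then show ?thesis
    unfolding mixture_low_eq L_def[symmetric] K_def[symmetric] r by blast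
qed

lemma coeffs_high_admissible:
  assumes "coeffs_high \<alpha> lO lE l" and f: "0 \<le> mixture_high \<alpha> lO lE l (2 * m + 1)"
  shows "\<exists>p q c. admissible p q (\<alpha>_max - \<alpha>) c \<and> mixture_high \<alpha> lO lE l = mixture m p q (\<alpha>_max - \<alpha>) c"
proof -
  define L where "L = (\<Sum>j=1..m. l j)"
  have \<alpha>: "1 / \<delta> < \<alpha>" "\<alpha> \<le> \<alpha>_max" and nonneg: "0 \<le> lO" "0 \<le> lE" "\<forall>j\<in>{1..m}. 0 \<le> l j"
    and total: "lO + lE + L = 1" and weight: "lE = \<alpha>_max / (1 - \<alpha>) - \<alpha> / (1 - \<alpha>)"
    using assms(1) by (simp_all add: coeffs_high_def L_def)
  have "\<alpha> < 1"
    using \<alpha> \<alpha>_max_less_1 by linarith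
  then have r: "lE * (1 - \<alpha>) = \<alpha>_max - \<alpha>"
    by (simp add: weight diff_divide_distrib[symmetric])
  define q where "q = (lO + lE) * \<alpha> + L * (1 - (1 - \<alpha>) * \<sigma>)"
  have eq: "mixture_high \<alpha> lO lE l = mixture m (lO * (1 - \<alpha>)) q (\<alpha>_max - \<alpha>) (\<lambda>j. l j * ((1 - \<alpha>) * \<sigma>))"
    unfolding mixture_high_eq L_def[symmetric] r q_def ..
  \<comment> \<open>The bid \<open>2 * m + 1\<close> has probability \<open>q / (m + 1)\<close>, so
    its sign decides that of \<open>q\<close>.\<close>
  have "0 \<le> q"
    using f unfolding eq mixture_last by (simp add: zero_le_divide_iff)
  have C: "(\<Sum>j=1..m. l j * ((1 - \<alpha>) * \<sigma>)) = L * ((1 - \<alpha>) * \<sigma>)"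
    by (simp only: L_def sum_distrib_right)
  have "admissible (lO * (1 - \<alpha>)) q (\<alpha>_max - \<alpha>) (\<lambda>j. l j * ((1 - \<alpha>) * \<sigma>))"
    unfolding admissible_iff C
  proof (intro conjI ballI)
    show sum: "lO * (1 - \<alpha>) + q + (\<alpha>_max - \<alpha>) + L * ((1 - \<alpha>) * \<sigma>) = 1"
      using total by (simp add: r[symmetric] q_def algebra_simps)
    have "1 / \<delta> = 1 - 1 / \<sigma>"
      using inverse_\<delta>_\<sigma> by simp
    then have "L * ((1 - \<alpha>) * \<sigma>) / \<delta> = L * ((1 - \<alpha>) * \<sigma>) * (1 - 1 / \<sigma>)"
      by (metis times_divide_eq_right mult_1_right)
    also have "\<dots> = L * ((1 - \<alpha>) * \<sigma>) - L * (1 - \<alpha>)"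
      using \<sigma>_pos by (simp add: right_diff_distrib)
    finally have "q + (\<alpha>_max - \<alpha>) + L * ((1 - \<alpha>) * \<sigma>) / \<delta> = 1 - (lO + L) * (1 - \<alpha>)"
      using sum by (simp add: algebra_simps)
    also have "lO + L = 1 - lE"
      using total by simp
    also have "1 - (1 - lE) * (1 - \<alpha>) = \<alpha>_max"
      using r by (simp add: algebra_simps)
    finally show "q + (\<alpha>_max - \<alpha>) + L * ((1 - \<alpha>) * \<sigma>) / \<delta> = \<alpha>_max" .
  qed (use nonneg \<alpha> \<open>\<alpha> < 1\<close> \<open>0 \<le> q\<close> \<sigma>_pos in auto)
  with eq show ?thesis
    by blast
qed

text \<open>The coefficients are not unique. The choice made here fixes the total weight of each
  \<open>V m j\<close> and splits every group between \<open>UO m\<close> and \<open>UE m\<close> in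
  the ratio \<open>p : r\<close>; for \<open>r = 0\<close> no \<open>UE m\<close> part remains, as
  case (iii) requires.\<close>

lemma admissible_coeffs_low:
  assumes "admissible p q r c" "\<alpha>_max - r \<le> 1 / \<delta>"
  shows "\<exists>lO lE l k. coeffs_low (\<alpha>_max - r) lO lE l k \<and> mixture_low (\<alpha>_max - r) lO lE l k = mixture m p q r c
    \<and> (r = 0 \<longrightarrow> lE = 0 \<and> k = (\<lambda>_. 0))"
proof -
  define \<alpha> C where "\<alpha> = \<alpha>_max - r" and "C = (\<Sum>j=1..m. c j)"
  have nonneg: "0 \<le> p" "0 \<le> q" "0 \<le> r" "\<And>j. j \<in> {1..m} \<Longrightarrow> 0 \<le> c j"
    and total: "p + q + r + C = 1" and qC: "q + C / \<delta> = \<alpha>"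
    using assms by (auto simp: admissible_iff \<alpha>_def C_def)
  have "0 \<le> C"
    using nonneg by (auto simp: C_def intro!: sum_nonneg)
  have \<delta>: "\<delta> > 0"
    using \<delta>_gt_1 by simp
  have "0 \<le> \<alpha>"
    using qC nonneg(2) \<open>0 \<le> C\<close> \<delta> by (simp flip: qC)
  have \<alpha>: "\<alpha> \<le> 1 / \<delta>" "\<alpha> < 1"
    using assms(2) inverse_\<delta>_less_1 by (simp_all add: \<alpha>_def)
  have \<alpha>\<delta>: "0 \<le> 1 - \<alpha> * \<delta>"
    using \<alpha> \<delta> by (simp add: field_simps)
  \<comment> \<open>For \<open>\<alpha> = 0\<close> division by zero gives 0, the right value
    because \<open>q\<close> and \<open>C\<close> then vanish.\<close>
  define s S where "s j = c j / (\<alpha> * \<delta>)" and "S = C / (\<alpha> * \<delta>)" for j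
  have sum_s: "(\<Sum>j=1..m. s j) = S"
    by (simp add: s_def S_def C_def sum_divide_distrib)
  have zero: "q = 0 \<and> C = 0" if "\<alpha> = 0"
    using qC nonneg \<open>0 \<le> C\<close> \<delta> that by (smt (verit) divide_nonneg_pos divide_pos_pos)
  have s: "s j * (\<alpha> * \<delta>) = c j" if "j \<in> {1..m}" for j
  proof -
    have "c j = 0" if "\<alpha> = 0"
      using zero[OF that] nonneg(4) \<open>j \<in> {1..m}\<close> unfolding C_def
      by (subst (asm) sum_nonneg_eq_0_iff) auto
    then show ?thesis
      using \<delta> by (auto simp: s_def)
  qed
  have C: "S * (\<alpha> * \<delta>) = C"
    using zero \<delta> by (auto simp: S_def)
  have q: "q = (1 - S) * \<alpha>"
  proof -
    have "C / \<delta> = S * \<alpha>"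
      using \<delta> by (simp flip: C)
    then show ?thesis
      using qC by (simp add: algebra_simps)
  qed
  have "S \<le> 1"
  proof (cases "\<alpha> = 0")
    case False
    then have "0 \<le> 1 - S"
      using q nonneg(2) \<open>0 \<le> \<alpha>\<close> by (simp add: zero_le_mult_iff)
    then show ?thesis by simp
  qed (simp add: S_def)
  have pr: "(1 - S) * (1 - \<alpha>) + S * (1 - \<alpha> * \<delta>) = p + r"
    using total unfolding q C[symmetric] by (simp add: algebra_simps)
  \<comment> \<open>If \<open>p + r = 0\<close>, then \<open>t\<close> is 0 by convention,
    consistent with \<open>r = 0\<close>.\<close>
  define t where "t = r / (p + r)"
  have t: "0 \<le> t" "t \<le> 1" "t * (p + r) = r"
    using nonneg by (auto simp: t_def divide_simps)
  define lO lE l k where "lO = (1 - t) * (1 - S)" and "lE = t * (1 - S)"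
    and "l j = (1 - t) * s j" and "k j = t * s j" for j
  have L: "(\<Sum>j=1..m. l j) = (1 - t) * S" and K: "(\<Sum>j=1..m. k j) = t * S"
    by (simp_all only: l_def k_def sum_distrib_left[symmetric] sum_s)
  have s_nonneg: "0 \<le> s j" if "j \<in> {1..m}" for j
    using nonneg(4)[OF that] \<open>0 \<le> \<alpha>\<close> \<delta> by (simp add: s_def)
  have r: "lE * (1 - \<alpha>) + t * S * (1 - \<alpha> * \<delta>) = r"
  proof -
    have "lE * (1 - \<alpha>) + t * S * (1 - \<alpha> * \<delta>) = t * ((1 - S) * (1 - \<alpha>) + S * (1 - \<alpha> * \<delta>))"
      unfolding lE_def by (simp only: distrib_left mult.assoc)
    then show ?thesis
      unfolding pr t(3) .
  qed
  have p: "lO * (1 - \<alpha>) + (1 - t) * S * (1 - \<alpha> * \<delta>) = p"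
  proof -
    have "lO * (1 - \<alpha>) + (1 - t) * S * (1 - \<alpha> * \<delta>) = (1 - t) * ((1 - S) * (1 - \<alpha>) + S * (1 - \<alpha> * \<delta>))"
      unfolding lO_def by (simp only: distrib_left mult.assoc)
    then show ?thesis
      unfolding pr using t(3) by (simp add: algebra_simps)
  qed
  have q': "(lO + lE) * \<alpha> = q"
    unfolding q lO_def lE_def by (simp add: algebra_simps)
  have c: "(l j + k j) * (\<alpha> * \<delta>) = c j" if "j \<in> {1..m}" for j
  proof -
    have "l j + k j = s j"
      by (simp add: l_def k_def algebra_simps)
    then show ?thesis
      using s[OF that] by simp
  qed
  have "coeffs_low \<alpha> lO lE l k"
    unfolding coeffs_low_def
  proof (intro conjI ballI)
    have "lE + (\<Sum>j=1..m. k j * (1 - \<alpha> * \<delta>) / (1 - \<alpha>)) = (lE * (1 - \<alpha>) + t * S * (1 - \<alpha> * \<delta>)) / (1 - \<alpha>)"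
      using \<alpha>(2) by (simp add: K[symmetric] sum_distrib_right sum_divide_distrib add_divide_distrib)
    then show "lE + (\<Sum>j=1..m. k j * (1 - \<alpha> * \<delta>) / (1 - \<alpha>)) = \<alpha>_max / (1 - \<alpha>) - \<alpha> / (1 - \<alpha>)"
      unfolding r by (simp add: \<alpha>_def diff_divide_distrib[symmetric])
    show "lO + lE + (\<Sum>j=1..m. l j) + (\<Sum>j=1..m. k j) = 1"
      unfolding L K lO_def lE_def by (simp add: algebra_simps)
  qed (use \<open>0 \<le> \<alpha>\<close> \<alpha> t \<open>S \<le> 1\<close> s_nonneg in \<open>auto simp: lO_def lE_def l_def k_def\<close>)
  moreover have "mixture_low \<alpha> lO lE l k = mixture m p q r c"
    unfolding mixture_low_eq L K p q' r using c by (auto simp: mixture_def fun_eq_iff intro!: sum.cong)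
  moreover have "r = 0 \<longrightarrow> lE = 0 \<and> k = (\<lambda>_. 0)"
    by (auto simp: t_def lE_def k_def)
  ultimately show ?thesis
    unfolding \<alpha>_def by blast
qed

text \<open>Here comparing the coefficients of \<open>UO m\<close>, \<open>UE m\<close> and
  \<open>V m j\<close> forces the weights, and \<open>\<alpha> < 1\<close> permits the
  divisions.\<close>

lemma admissible_coeffs_high:
  assumes "admissible p q r c" "1 / \<delta> < \<alpha>_max - r"
  shows "\<exists>lO lE l. coeffs_high (\<alpha>_max - r) lO lE l \<and> mixture_high (\<alpha>_max - r) lO lE l = mixture m p q r c"
proof -
  define \<alpha> C where "\<alpha> = \<alpha>_max - r" and "C = (\<Sum>j=1..m. c j)"
  have nonneg: "0 \<le> p" "0 \<le> q" "0 \<le> r" "\<And>j. j \<in> {1..m} \<Longrightarrow> 0 \<le> c j"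
    and total: "p + q + r + C = 1" and qC: "q + C / \<delta> = \<alpha>"
    using assms by (auto simp: admissible_iff \<alpha>_def C_def)
  have "\<alpha> < 1"
    using nonneg \<alpha>_max_less_1 by (simp add: \<alpha>_def)
  have nz: "1 - \<alpha> \<noteq> 0" "\<sigma> \<noteq> 0"
    using \<open>\<alpha> < 1\<close> \<sigma>_pos by auto
  define l where "l j = c j / ((1 - \<alpha>) * \<sigma>)" for j
  have L: "(\<Sum>j=1..m. l j) = C / ((1 - \<alpha>) * \<sigma>)"
    by (simp add: l_def C_def sum_divide_distrib)
  have "C / \<delta> + C / \<sigma> = C"
    using inverse_\<delta>_\<sigma> by (metis distrib_left mult_1_right times_divide_eq_right)
  \<comment> \<open>Total mass minus the slope equation; after division by
    \<open>1 - \<alpha>\<close> it says that the new weights add up to 1.\<close>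
  then have prC: "p + r + C / \<sigma> = 1 - \<alpha>"
    using total qC by linarith
  have sum1: "p / (1 - \<alpha>) + r / (1 - \<alpha>) + C / ((1 - \<alpha>) * \<sigma>) = 1"
  proof -
    have "p / (1 - \<alpha>) + r / (1 - \<alpha>) + C / ((1 - \<alpha>) * \<sigma>) = (p + r + C / \<sigma>) / (1 - \<alpha>)"
      by (simp add: add_divide_distrib mult.commute)
    then show ?thesis
      using nz by (simp add: prC)
  qed
  have "coeffs_high \<alpha> (p / (1 - \<alpha>)) (r / (1 - \<alpha>)) l"
    unfolding coeffs_high_def L
    using sum1 assms(2) nonneg \<open>\<alpha> < 1\<close> \<sigma>_pos
    by (auto simp: \<alpha>_def[symmetric] l_def diff_divide_distrib[symmetric]) (auto simp: \<alpha>_def)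
  moreover have "mixture_high \<alpha> (p / (1 - \<alpha>)) (r / (1 - \<alpha>)) l = mixture m p q r c"
  proof -
    have q: "(p / (1 - \<alpha>) + r / (1 - \<alpha>)) * \<alpha> + C / ((1 - \<alpha>) * \<sigma>) * (1 - (1 - \<alpha>) * \<sigma>) = q"
    proof -
      have "C / ((1 - \<alpha>) * \<sigma>) * (1 - (1 - \<alpha>) * \<sigma>) = C / ((1 - \<alpha>) * \<sigma>) - C"
        using nz by (simp add: right_diff_distrib)
      moreover have "(p / (1 - \<alpha>) + r / (1 - \<alpha>)) * \<alpha> = p / (1 - \<alpha>) + r / (1 - \<alpha>) - (p + r)"
      proof -
        have "x * \<alpha> = x - x * (1 - \<alpha>)" for x
          by (simp add: right_diff_distrib)
        moreover have "(p / (1 - \<alpha>) + r / (1 - \<alpha>)) * (1 - \<alpha>) = p + r"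
          using nz by (simp add: distrib_right)
        ultimately show ?thesis
          by metis
      qed
      ultimately show ?thesis
        using sum1 total by linarith
    qed
    have "p / (1 - \<alpha>) * (1 - \<alpha>) = p" "r / (1 - \<alpha>) * (1 - \<alpha>) = r" "l j * ((1 - \<alpha>) * \<sigma>) = c j" for j
      using nz by (simp_all add: l_def)
    then show ?thesis
      unfolding mixture_high_eq L q by simp
  qed
  ultimately show ?thesis
    unfolding \<alpha>_def by blast
qed

end

section \<open>Cases (ii) and (iii) in the form of the theorem\<close>

lemma weak_strategy_boundary: "weak_strategy m (real m + 1) n = UE m n"
  by (auto simp: weak_strategy_def UE_def field_simps)

lemma weak_strategy_eq_mixture:
  assumes "m > 0" "a > 0"
  defines "w \<equiv> real m * (real m + 1) / a"
  shows "weak_strategy m a n = (1 - w / real m) * dirac0 n + w / real m * UE m n"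
proof -
  have "w / real m = (real m + 1) / a"
    using assms by simp
  moreover have "(real m + 1) / a / (real m + 1) = 1 / a"
    by simp
  ultimately show ?thesis
    using assms(2) by (auto simp: weak_strategy_def dirac0_def UE_def add.commute add_divide_distrib[symmetric] diff_divide_distrib[symmetric])
qed

context auction
begin

definition low :: "nat pmf \<Rightarrow> real \<Rightarrow> bool" where
  "low X \<alpha> \<longleftrightarrow> (\<exists>lO lE l k. coeffs_low \<alpha> lO lE l k \<and> (\<forall>n. pmf X n = mixture_low \<alpha> lO lE l k n))"

definition high :: "nat pmf \<Rightarrow> real \<Rightarrow> bool" where
  "high X \<alpha> \<longleftrightarrow> (\<exists>lO lE l. coeffs_high \<alpha> lO lE l \<and> (\<forall>n. pmf X n = mixture_high \<alpha> lO lE l n))"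

text \<open>Together the two parametrisations cover all admissible mixtures, and the parameter is
  determined by the weight of \<open>UE m\<close>; its position relative to
  \<open>1 / \<delta>\<close> selects the parametrisation.\<close>

lemma low_or_high_iff:
  "low X \<alpha> \<or> high X \<alpha> \<longleftrightarrow>
    (\<exists>p q r c. admissible p q r c \<and> \<alpha> = \<alpha>_max - r \<and> (\<forall>n. pmf X n = mixture m p q r c n))"
    (is "?L \<longleftrightarrow> ?R")
proof
  assume ?L
  then show ?R
  proof
    assume "low X \<alpha>"
    then obtain p q c where "admissible p q (\<alpha>_max - \<alpha>) c" "\<forall>n. pmf X n = mixture m p q (\<alpha>_max - \<alpha>) c n"
      unfolding low_def using coeffs_low_admissible by metis
    then show ?R
      by (intro exI[of _ p] exI[of _ q] exI[of _ "\<alpha>_max - \<alpha>"] exI[of _ c]) simp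
  next
    assume "high X \<alpha>"
    then obtain lO lE l where h: "coeffs_high \<alpha> lO lE l" and X: "\<forall>n. pmf X n = mixture_high \<alpha> lO lE l n"
      by (auto simp: high_def)
    have "0 \<le> mixture_high \<alpha> lO lE l (2 * m + 1)"
      by (metis X pmf_nonneg)
    with h obtain p q c where "admissible p q (\<alpha>_max - \<alpha>) c" "mixture_high \<alpha> lO lE l = mixture m p q (\<alpha>_max - \<alpha>) c"
      using coeffs_high_admissible by blast
    with X show ?R
      by (intro exI[of _ p] exI[of _ q] exI[of _ "\<alpha>_max - \<alpha>"] exI[of _ c]) simp
  qed
next
  assume ?R
  then obtain p q r c where adm: "admissible p q r c" and \<alpha>: "\<alpha> = \<alpha>_max - r"
    and X: "\<forall>n. pmf X n = mixture m p q r c n"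
    by blast
  show ?L
    using admissible_coeffs_low[OF adm] admissible_coeffs_high[OF adm] X
    unfolding low_def high_def \<alpha> by (metis not_le)
qed

text \<open>Only \<open>UE m\<close> charges the bid 0, and its weight is
  \<open>\<alpha>_max - \<alpha>\<close>.\<close>

lemma low_or_high_0:
  assumes "low X \<alpha> \<or> high X \<alpha>"
  shows "pmf X 0 = (\<alpha>_max - \<alpha>) / (real m + 1)"
proof -
  obtain p q r c where "\<alpha> = \<alpha>_max - r" "\<forall>n. pmf X n = mixture m p q r c n"
    using assms low_or_high_iff by blast
  then show ?thesis
    using mixture_even[of 0 m p q r c] by (simp add: add.commute)
qed

lemma nash_eq_iff_boundary:
  assumes a: "a = real m + 1" and v: "v1 = 2 * a" "v2 = 2 * b" and "strategy X" "strategy Y"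
  shows "nash_eq v1 v2 X Y \<longleftrightarrow> (\<forall>n. pmf Y n = UE m n) \<and> (\<exists>\<alpha>. low X \<alpha> \<or> high X \<alpha>)"
proof -
  have "(\<exists>\<alpha>. low X \<alpha> \<or> high X \<alpha>) \<longleftrightarrow> (\<exists>p q r c. admissible p q r c \<and> (\<forall>n. pmf X n = mixture m p q r c n))"
    unfolding low_or_high_iff by blast
  then show ?thesis
    using nash_eq_iff_weak[of a X Y] assms by (simp add: weak_strategy_boundary)
qed

lemma nash_eq_boundary_payoffs:
  assumes a: "a = real m + 1" and v: "v1 = 2 * a" "v2 = 2 * b" and nash: "nash_eq v1 v2 X Y"
  shows "payoff v1 X Y = 1"
    and "low X \<alpha> \<or> high X \<alpha> \<Longrightarrow> payoff v2 Y X = 1 - v2 / v1 * \<alpha> - (v1 - v2) / 2"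
proof -
  have Y: "pmf Y n = weak_strategy m a n" for n
    unfolding a weak_strategy_boundary
    using nash nash_eq_iff_boundary[OF a v, of X Y] by (auto simp: nash_eq_def)
  note payoffs = nash_eq_weak_payoffs[OF _ nash[unfolded v] Y, folded v]
  show "payoff v1 X Y = 1"
    using payoffs(1) a v by simp
  assume "low X \<alpha> \<or> high X \<alpha>"
  then have "payoff v2 Y X = b * ((\<alpha>_max - \<alpha>) / (real m + 1))"
    using payoffs(2) a low_or_high_0 by simp
  also have "\<dots> = b * \<alpha>_max / (real m + 1) - b / (real m + 1) * \<alpha>"
    by (simp add: right_diff_distrib diff_divide_distrib)
  also have "b * \<alpha>_max / (real m + 1) = b - real m"
    using b_pos by (simp add: \<alpha>_max_def)
  also have "b / (real m + 1) = v2 / v1"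
    unfolding v a by (rule mult_divide_mult_cancel_left[symmetric]) simp
  also have "b - real m = 1 - (v1 - v2) / 2"
    unfolding v a by (simp add: field_simps)
  finally show "payoff v2 Y X = 1 - v2 / v1 * \<alpha> - (v1 - v2) / 2"
    by simp
qed

lemma admissible_0_iff:
  "(\<exists>p q r c. admissible p q r c \<and> r = 0 \<and> (\<forall>n. pmf X n = mixture m p q r c n)) \<longleftrightarrow>
   (\<exists>\<mu>0 \<mu>. 0 \<le> \<mu>0 \<and> (\<forall>j\<in>{1..m}. 0 \<le> \<mu> j) \<and> \<mu>0 + (\<Sum>j=1..m. \<mu> j) = 1 \<and>
      (\<forall>n. pmf X n = \<mu>0 * ((1 - \<alpha>_max) * UO m n + \<alpha>_max * UO (m + 1) n) +
        (\<Sum>j=1..m. \<mu> j * (if b \<le> real m + 1 - 1 / 2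
           then \<alpha>_max * \<delta> * V m j n + (1 - \<alpha>_max * \<delta>) * UO m n
           else (1 - \<alpha>_max) * \<sigma> * V m j n + (1 - (1 - \<alpha>_max) * \<sigma>) * UO (m + 1) n))))"
    (is "?L \<longleftrightarrow> ?R")
proof -
  have L: "?L \<longleftrightarrow> (\<exists>p q c. admissible p q 0 c \<and> (\<forall>n. pmf X n = mixture m p q 0 c n))"
    by auto
  show ?thesis
  proof (cases "\<alpha>_max \<le> 1 / \<delta>")
    case True
    then have b: "b \<le> real m + 1 - 1 / 2"
      by (simp add: \<alpha>_max_le_iff)
    have "coeffs_low \<alpha>_max \<mu>0 0 \<mu> (\<lambda>_. 0) \<longleftrightarrow>
        0 \<le> \<mu>0 \<and> (\<forall>j\<in>{1..m}. 0 \<le> \<mu> j) \<and> \<mu>0 + (\<Sum>j=1..m. \<mu> j) = 1" for \<mu>0 \<mu>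
      using True \<alpha>_max_pos by (auto simp: coeffs_low_def)
    moreover have "mixture_low \<alpha>_max \<mu>0 0 \<mu> (\<lambda>_. 0) n = \<mu>0 * ((1 - \<alpha>_max) * UO m n + \<alpha>_max * UO (m + 1) n) +
        (\<Sum>j=1..m. \<mu> j * (\<alpha>_max * \<delta> * V m j n + (1 - \<alpha>_max * \<delta>) * UO m n))" for \<mu>0 \<mu> n
      by (simp add: mixture_low_def)
    ultimately have "?R \<longleftrightarrow> (\<exists>\<mu>0 \<mu>. coeffs_low \<alpha>_max \<mu>0 0 \<mu> (\<lambda>_. 0) \<and>
        (\<forall>n. pmf X n = mixture_low \<alpha>_max \<mu>0 0 \<mu> (\<lambda>_. 0) n))"
      using b by simp
    also have "\<dots> \<longleftrightarrow> (\<exists>p q c. admissible p q 0 c \<and> (\<forall>n. pmf X n = mixture m p q 0 c n))"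
    proof
      assume "\<exists>\<mu>0 \<mu>. coeffs_low \<alpha>_max \<mu>0 0 \<mu> (\<lambda>_. 0) \<and> (\<forall>n. pmf X n = mixture_low \<alpha>_max \<mu>0 0 \<mu> (\<lambda>_. 0) n)"
      then show "\<exists>p q c. admissible p q 0 c \<and> (\<forall>n. pmf X n = mixture m p q 0 c n)"
        using coeffs_low_admissible[of \<alpha>_max] unfolding diff_self by metis
    next
      assume "\<exists>p q c. admissible p q 0 c \<and> (\<forall>n. pmf X n = mixture m p q 0 c n)"
      then show "\<exists>\<mu>0 \<mu>. coeffs_low \<alpha>_max \<mu>0 0 \<mu> (\<lambda>_. 0) \<and> (\<forall>n. pmf X n = mixture_low \<alpha>_max \<mu>0 0 \<mu> (\<lambda>_. 0) n)"
        using admissible_coeffs_low[where r = 0] True unfolding diff_0_right by metis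
    qed
    finally show ?thesis
      using L by blast
  next
    case False
    then have b: "\<not> b \<le> real m + 1 - 1 / 2"
      by (simp add: \<alpha>_max_le_iff)
    have iff: "coeffs_high \<alpha>_max \<mu>0 lE \<mu> \<longleftrightarrow> lE = 0 \<and>
        0 \<le> \<mu>0 \<and> (\<forall>j\<in>{1..m}. 0 \<le> \<mu> j) \<and> \<mu>0 + (\<Sum>j=1..m. \<mu> j) = 1" for \<mu>0 lE \<mu>
      using False by (auto simp: coeffs_high_def)
    moreover have "mixture_high \<alpha>_max \<mu>0 0 \<mu> n = \<mu>0 * ((1 - \<alpha>_max) * UO m n + \<alpha>_max * UO (m + 1) n) +
        (\<Sum>j=1..m. \<mu> j * ((1 - \<alpha>_max) * \<sigma> * V m j n + (1 - (1 - \<alpha>_max) * \<sigma>) * UO (m + 1) n))" for \<mu>0 \<mu> n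
      by (simp add: mixture_high_def)
    ultimately have "?R \<longleftrightarrow> high X \<alpha>_max"
      using b by (simp add: high_def)
    \<comment> \<open>The low parametrisation is impossible here, as \<open>\<alpha>_max\<close>
      exceeds \<open>1 / \<delta>\<close>.\<close>
    also have "\<dots> \<longleftrightarrow> low X \<alpha>_max \<or> high X \<alpha>_max"
      using False by (auto simp: low_def coeffs_low_def)
    also have "\<dots> \<longleftrightarrow> ?L"
      unfolding low_or_high_iff by auto
    finally show ?thesis
      by blast
  qed
qed

lemma nash_eq_iff_strong:
  assumes a: "a > real m + 1" and v: "v1 = 2 * a" "v2 = 2 * b" and "strategy X" "strategy Y"
  shows "nash_eq v1 v2 X Y \<longleftrightarrow>
     (\<forall>n. pmf Y n = (1 - real m * (real m + 1) / a / real m) * dirac0 n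
        + real m * (real m + 1) / a / real m * UE m n) \<and>
     (\<exists>p q r c. admissible p q r c \<and> r = 0 \<and> (\<forall>n. pmf X n = mixture m p q r c n))"
  using nash_eq_iff_weak[of a X Y] assms weak_strategy_eq_mixture[of m a] m_pos by simp

lemma nash_eq_strong_payoffs:
  assumes a: "a > real m + 1" and v: "v1 = 2 * a" "v2 = 2 * b" and nash: "nash_eq v1 v2 X Y"
  shows "payoff v1 X Y = v1 + 1 - 2 * (real m + 1)" "payoff v2 Y X = 0"
proof -
  have str: "strategy X" "strategy Y"
    using nash by (auto simp: nash_eq_def)
  have Y: "pmf Y n = weak_strategy m a n" for n
    using nash nash_eq_iff_weak[of a X Y] str a v by simp
  note payoffs = nash_eq_weak_payoffs[OF _ nash[unfolded v] Y, folded v]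
  show "payoff v1 X Y = v1 + 1 - 2 * (real m + 1)"
    using payoffs(1) a v by simp
  obtain p q c where "\<forall>n. pmf X n = mixture m p q 0 c n"
    using nash nash_eq_iff_strong[OF a v str] by auto
  then have "pmf X 0 = 0"
    using mixture_even[of 0 m p q 0 c] by simp
  then show "payoff v2 Y X = 0"
    using payoffs(2) a by simp
qed

end

section \<open>The three cases for the given valuations\<close>

theorem theorem2:
  fixes v1 v2 :: real and X Y :: "nat pmf"
  assumes hv: "v1 \<ge> v2" "v2 > 2"
    and hnint: "v2 / 2 \<notin> \<int>"
    and hX: "strategy X" and hY: "strategy Y"
  defines "m \<equiv> nat \<lfloor>v2 / 2\<rfloor>"
  defines "\<delta> \<equiv> real (2 * m + 1) / real (m + 1)"
  defines "\<sigma> \<equiv> real (2 * m + 1) / real m"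
  shows
  \<comment> \<open>(i)\<close>
  "(\<lfloor>v1 / 2\<rfloor> = \<lfloor>v2 / 2\<rfloor> \<longrightarrow>
     (let kap = of_int \<lfloor>v1 / 2\<rfloor> / (v1 / 2) * (of_int \<lceil>v1 / 2\<rceil> - v1 / 2);
          lam = of_int \<lfloor>v2 / 2\<rfloor> / (v2 / 2) * (of_int \<lceil>v2 / 2\<rceil> - v2 / 2)
      in (nash_eq v1 v2 X Y \<longleftrightarrow>
            (\<forall>n. pmf X n = lam * UO m n + (1 - lam) * UE m n) \<and>
            (\<forall>n. pmf Y n = kap * UO m n + (1 - kap) * UE m n)) \<and>
         (nash_eq v1 v2 X Y \<longrightarrow>
            payoff v1 X Y = v1 / 2 - of_int \<lfloor>v2 / 2\<rfloor> \<and>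
            payoff v2 Y X = v2 / 2 - of_int \<lfloor>v2 / 2\<rfloor>)))
   \<and>
  \<comment> \<open>(ii)\<close>
  (v1 / 2 = of_int \<lfloor>v2 / 2\<rfloor> + 1 \<longrightarrow>
     (let abar = of_int \<lceil>v2 / 2\<rceil> / (v2 / 2) * (v2 / 2 - of_int \<lfloor>v2 / 2\<rfloor>);
          descA = (\<lambda>\<alpha>. \<exists>lO lE (l :: nat \<Rightarrow> real) (k :: nat \<Rightarrow> real).
              0 \<le> \<alpha> \<and> \<alpha> \<le> 1 / \<delta> \<and>
              0 \<le> lO \<and> 0 \<le> lE \<and> (\<forall>j\<in>{1..m}. 0 \<le> l j \<and> 0 \<le> k j) \<and>
              lO + lE + (\<Sum>j=1..m. l j) + (\<Sum>j=1..m. k j) = 1 \<and>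
              lE + (\<Sum>j=1..m. k j * (1 - \<alpha> * \<delta>) / (1 - \<alpha>))
                = abar / (1 - \<alpha>) - \<alpha> / (1 - \<alpha>) \<and>
              (\<forall>n. pmf X n =
                 lO * ((1 - \<alpha>) * UO m n + \<alpha> * UO (m + 1) n)
               + lE * ((1 - \<alpha>) * UE m n + \<alpha> * UO (m + 1) n)
               + (\<Sum>j=1..m. l j * (\<alpha> * \<delta> * V m j n + (1 - \<alpha> * \<delta>) * UO m n))
               + (\<Sum>j=1..m. k j * (\<alpha> * \<delta> * V m j n + (1 - \<alpha> * \<delta>) * UE m n))));
          descB = (\<lambda>\<alpha>. \<exists>lO lE (l :: nat \<Rightarrow> real).
              1 / \<delta> < \<alpha> \<and> \<alpha> \<le> abar \<and>
              0 \<le> lO \<and> 0 \<le> lE \<and> (\<forall>j\<in>{1..m}. 0 \<le> l j) \<and>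
              lO + lE + (\<Sum>j=1..m. l j) = 1 \<and>
              lE = abar / (1 - \<alpha>) - \<alpha> / (1 - \<alpha>) \<and>
              (\<forall>n. pmf X n =
                 lO * ((1 - \<alpha>) * UO m n + \<alpha> * UO (m + 1) n)
               + lE * ((1 - \<alpha>) * UE m n + \<alpha> * UO (m + 1) n)
               + (\<Sum>j=1..m. l j * ((1 - \<alpha>) * \<sigma> * V m j n
                                     + (1 - (1 - \<alpha>) * \<sigma>) * UO (m + 1) n))))
      in (nash_eq v1 v2 X Y \<longleftrightarrow>
            (\<forall>n. pmf Y n = UE m n) \<and> (\<exists>\<alpha>. descA \<alpha> \<or> descB \<alpha>)) \<and>
         (nash_eq v1 v2 X Y \<longrightarrow>
            payoff v1 X Y = 1 \<and>
            (\<forall>\<alpha>. descA \<alpha> \<or> descB \<alpha> \<longrightarrow>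
               payoff v2 Y X = 1 - v2 / v1 * \<alpha> - (v1 - v2) / 2))))
   \<and>
  \<comment> \<open>(iii)\<close>
  (v1 / 2 > of_int \<lfloor>v2 / 2\<rfloor> + 1 \<longrightarrow>
     (let b = of_int \<lfloor>v2 / 2\<rfloor> * of_int \<lceil>v2 / 2\<rceil> / (v1 / 2);
          \<alpha> = of_int \<lceil>v2 / 2\<rceil> / (v2 / 2) * (v2 / 2 - of_int \<lfloor>v2 / 2\<rfloor>);
          A = (\<lambda>n. (1 - \<alpha>) * UO m n + \<alpha> * UO (m + 1) n);
          B = (\<lambda>j n. if v2 / 2 \<le> of_int \<lceil>v2 / 2\<rceil> - 1 / 2
                      then \<alpha> * \<delta> * V m j n + (1 - \<alpha> * \<delta>) * UO m n
                      else (1 - \<alpha>) * \<sigma> * V m j n + (1 - (1 - \<alpha>) * \<sigma>) * UO (m + 1) n)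
      in (nash_eq v1 v2 X Y \<longleftrightarrow>
            (\<forall>n. pmf Y n = (1 - b / real m) * dirac0 n + b / real m * UE m n) \<and>
            (\<exists>\<mu>0 (\<mu> :: nat \<Rightarrow> real).
               0 \<le> \<mu>0 \<and> (\<forall>j\<in>{1..m}. 0 \<le> \<mu> j) \<and> \<mu>0 + (\<Sum>j=1..m. \<mu> j) = 1 \<and>
               (\<forall>n. pmf X n = \<mu>0 * A n + (\<Sum>j=1..m. \<mu> j * B j n)))) \<and>
         (nash_eq v1 v2 X Y \<longrightarrow>
            payoff v1 X Y = v1 + 1 - 2 * of_int \<lceil>v2 / 2\<rceil> \<and>
            payoff v2 Y X = 0)))"
proof -
  note ratios = \<delta>_def \<sigma>_def
  have m: "real m \<le> v2 / 2" "v2 / 2 < real m + 1" "m > 0"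
  proof -
    have "1 \<le> \<lfloor>v2 / 2\<rfloor>"
      using hv by (simp add: le_floor_iff)
    then have m_int: "\<lfloor>v2 / 2\<rfloor> = int m"
      by (simp add: m_def)
    then show "m > 0"
      using \<open>1 \<le> \<lfloor>v2 / 2\<rfloor>\<close> by simp
    show "real m \<le> v2 / 2" "v2 / 2 < real m + 1"
      using m_int floor_correct[of "v2 / 2"] by simp_all
  qed
  \<comment> \<open>Non-integrality turns the lower floor bound into the strict inequality of the
    locale.\<close>
  moreover have "v2 / 2 \<noteq> real m"
    using hnint by (metis Ints_of_nat)
  ultimately interpret auction m "v2 / 2"
    by unfold_locales auto
  have floor: "\<lfloor>v2 / 2\<rfloor> = int m" and ceiling: "\<lceil>v2 / 2\<rceil> = int m + 1"
    using b_gt b_less by (simp_all add: floor_eq_iff ceiling_eq_iff)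
  have of_floor: "real_of_int \<lfloor>v2 / 2\<rfloor> = real m" and of_ceiling: "real_of_int \<lceil>v2 / 2\<rceil> = real m + 1"
    by (simp_all add: floor ceiling)
  have \<delta>_eq: "\<delta> = auction.\<delta> m" and \<sigma>_eq: "\<sigma> = auction.\<sigma> m"
    unfolding ratios auction.\<delta>_def[OF auction_axioms] auction.\<sigma>_def[OF auction_axioms] by (rule refl)+
  have v: "v1 = 2 * (v1 / 2)" "v2 = 2 * (v2 / 2)"
    by simp_all
  show ?thesis
  proof (intro conjI impI, goal_cases)
    case fl: 1
    \<comment> \<open>Since \<open>v1 \<ge> v2\<close>, the half-valuation of player 1 also lies
      strictly above \<open>m\<close>, so its ceiling is \<open>m + 1\<close> too.\<close>
    then have "real m \<le> v1 / 2" "v1 / 2 < real m + 1" "real m < v1 / 2"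
      using floor hv b_gt by (auto simp: floor_eq_iff)
    then interpret balanced_auction m "v2 / 2" "v1 / 2"
      by unfold_locales
    have ceiling1: "\<lceil>v1 / 2\<rceil> = int m + 1"
      using a_gt a_less by (simp add: ceiling_eq_iff)
    have of_1: "real_of_int \<lfloor>v1 / 2\<rfloor> = real m" "real_of_int \<lceil>v1 / 2\<rceil> = real m + 1"
      by (simp_all add: fl floor ceiling1)
    show ?case
      unfolding Let_def of_1 of_floor of_ceiling UO_UE_eq_balanced a.UO_UE_eq_balanced
      using nash_eq_iff_balanced[OF hX hY] nash_eq_balanced_payoffs[of X Y] by simp
  next
    case a: 2
    note a' = a[unfolded of_floor]
    note iff = nash_eq_iff_boundary[OF a' v hX hY]
    note payoffs = nash_eq_boundary_payoffs[OF a' v, of X Y]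
    have "(nash_eq v1 v2 X Y \<longleftrightarrow> (\<forall>n. pmf Y n = UE m n) \<and> (\<exists>\<alpha>. low X \<alpha> \<or> high X \<alpha>)) \<and>
       (nash_eq v1 v2 X Y \<longrightarrow> payoff v1 X Y = 1 \<and>
         (\<forall>\<alpha>. low X \<alpha> \<or> high X \<alpha> \<longrightarrow> payoff v2 Y X = 1 - v2 / v1 * \<alpha> - (v1 - v2) / 2))"
      using iff payoffs by blast
    then show ?case
      unfolding Let_def of_floor of_ceiling \<delta>_eq \<sigma>_eq low_def high_def coeffs_low_def coeffs_high_def
        mixture_low_def mixture_high_def \<alpha>_max_def conj_assoc .
  next
    case a: 3
    note a' = a[unfolded of_floor]
    show ?case
      unfolding Let_def of_floor of_ceiling \<delta>_eq \<sigma>_eq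
      using nash_eq_iff_strong[OF a' v hX hY, unfolded admissible_0_iff \<alpha>_max_def]
        nash_eq_strong_payoffs[OF a' v, of X Y] by blast
  qed
qed

end
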